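(* Let $\alpha\in(0,\tfrac12]$, $s=p^{1-\alpha}$, $\delta>0$, and $A=\sqrt{p^{\alpha-\frac12-\delta}/n}$. 1. Assume either $\mathbf X\in\mathrm{SubG}(\sigma^2)$ with $n/p\to\infty$, or $\mathbf X\in\mathcal O_n(p)$ with $n\ge p$. If $\delta<\tfrac12$, then $$\liminf_{p\to\infty}\frac{\log(1-\mathrm{Risk}(s,A))}{\log p}\ \ge\ -\delta .$$ 2. Assume either $\mathbf X\in\mathrm{SubG}(\sigma^2)$ with $n/p^{1+2\delta}\to\infty$, or $\mathbf X\in\mathcal O_n(p)$ with $n\ge p$. Then $$\liminf_{p\to\infty}\frac{\log(1-\mathrm{Risk}(s,A))}{\log p}\ \le\ -\delta .$$
   Context: Setting: for each $p$ one observes $(\mathbf y,\mathbf X)$ with $\mathbf y=\mathbf X\boldsymbol\beta+\boldsymbol\varepsilon$, where $\boldsymbol\varepsilon\sim\mathcal N(0,I_n)$, $\mathbf X$ is an $n\times p$ real matrix independent of $\boldsymbol\varepsilon$, $\boldsymbol\beta\in\mathbb R^p$ is unknown, and $n=n(p)\to\infty$ as $p\to\infty$. Design classes: $\mathbf X\in\mathrm{SubG}(\sigma^2)$ means the rows of $\mathbf X$ are i.i.d. centered isotropic ($\mathbb E[xx^T]=I_p$) sub-Gaussian random vectors with sub-Gaussian parameter $\sigma^2$ (for every unit $u$ and $t\in\mathbb R$, $\log\mathbb E e^{t\langle u,x\rangle}\le\sigma^2t^2/2$), and $\mathbf X^T\mathbf X$ is almost surely positive definite; $\mathbf X\in\mathcal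 O_n(p)$ means $\mathbf X^T\mathbf X=nI_p$. For an integer $s$ and $A>0$, $\Xi(s,A)=\{\boldsymbol\beta\in\mathbb R^p:|\mathrm{supp}(\boldsymbol\beta)|=s,\ |\beta_i|\ge A\text{ for }i\in\mathrm{supp}(\boldsymbol\beta)\}$. A test $T$ is a measurable $[0,1]$-valued function of $(\mathbf y,\mathbf X)$; $\mathbb P_{\boldsymbol\beta},\mathbb E_{\boldsymbol\beta}$ denote the law/expectation of $(\mathbf y,\mathbf X)$ (including the randomness of $\mathbf X$) under parameter $\boldsymbol\beta$, and $\mathbb P_0,\mathbb E_0$ those under $\boldsymbol\beta=0$. $\mathrm{Risk}(T,s,A)=\mathbb E_0[T]+\sup_{\boldsymbol\beta\in\Xi(s,A)}\mathbb E_{\boldsymbol\beta}[1-T]$ and $\mathrm{Risk}(s,A)=\inf_T\mathrm{Risk}(T,s,A)$. The sparsity is $s=p^{1-\alpha}$ (rounded to an integer) with $\alpha$ fixed; all limits are as $p\to\infty$. *)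

theory Defs
  imports "HOL-Probability.Probability"
begin

text \<open>Conventions. An n x p real matrix is a function on index pairs (i,j) with i<n, j<p,
  living in the product space below. Vectors in R^n are functions on indices i<n.
  A parameter beta in R^p is a function nat => real vanishing outside {..<p}.\<close>

definition vec_space :: "nat \<Rightarrow> (nat \<Rightarrow> real) measure" where
  "vec_space n = PiM {..<n} (\<lambda>_. borel)"

definition design_space :: "nat \<Rightarrow> nat \<Rightarrow> (nat \<times> nat \<Rightarrow> real) measure" where
  "design_space n p = PiM ({..<n} \<times> {..<p}) (\<lambda>_. borel)"

definition obs_space :: "nat \<Rightarrow> nat \<Rightarrow> ((nat \<Rightarrow> real) \<times> (nat \<times> nat \<Rightarrow> real)) measure" where
  "obs_space n p = vec_space n \<Otimes>\<^sub>M design_space n p"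

definition gauss :: "nat \<Rightarrow> (nat \<Rightarrow> real) measure" where
  "gauss n = PiM {..<n} (\<lambda>_. density lborel std_normal_density)"

definition obs_law ::
  "(nat \<times> nat \<Rightarrow> real) measure \<Rightarrow> nat \<Rightarrow> nat \<Rightarrow> (nat \<Rightarrow> real)
   \<Rightarrow> ((nat \<Rightarrow> real) \<times> (nat \<times> nat \<Rightarrow> real)) measure" where
  "obs_law D n p \<beta> = distr (D \<Otimes>\<^sub>M gauss n) (obs_space n p)
     (\<lambda>(X, e). ((\<lambda>i\<in>{..<n}. (\<Sum>j<p. X (i, j) * \<beta> j) + e i), X))"

definition tests :: "nat \<Rightarrow> nat \<Rightarrow> ((nat \<Rightarrow> real) \<times> (nat \<times> nat \<Rightarrow> real) \<Rightarrow> real) set" where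
  "tests n p = {T. T \<in> borel_measurable (obs_space n p) \<and>
                   (\<forall>\<omega>\<in>space (obs_space n p). 0 \<le> T \<omega> \<and> T \<omega> \<le> 1)}"

definition Xi :: "nat \<Rightarrow> nat \<Rightarrow> real \<Rightarrow> (nat \<Rightarrow> real) set" where
  "Xi p s A = {\<beta>. (\<forall>j\<ge>p. \<beta> j = 0) \<and> card {j. j < p \<and> \<beta> j \<noteq> 0} = s \<and>
                   (\<forall>j<p. \<beta> j \<noteq> 0 \<longrightarrow> \<bar>\<beta> j\<bar> \<ge> A)}"

definition risk_test ::
  "(nat \<times> nat \<Rightarrow> real) measure \<Rightarrow> nat \<Rightarrow> nat \<Rightarrow> nat \<Rightarrow> real
   \<Rightarrow> ((nat \<Rightarrow> real) \<times> (nat \<times> nat \<Rightarrow> real) \<Rightarrow> real) \<Rightarrow> real" where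
  "risk_test D n p s A T =
     (\<integral>\<omega>. T \<omega> \<partial>obs_law D n p (\<lambda>_. 0))
     + (SUP \<beta>\<in>Xi p s A. \<integral>\<omega>. 1 - T \<omega> \<partial>obs_law D n p \<beta>)"

definition minimax_risk ::
  "(nat \<times> nat \<Rightarrow> real) measure \<Rightarrow> nat \<Rightarrow> nat \<Rightarrow> nat \<Rightarrow> real \<Rightarrow> real" where
  "minimax_risk D n p s A = (INF T\<in>tests n p. risk_test D n p s A T)"

definition subG_design :: "real \<Rightarrow> nat \<Rightarrow> nat \<Rightarrow> (nat \<times> nat \<Rightarrow> real) measure \<Rightarrow> bool" where
  "subG_design \<sigma>2 n p D \<longleftrightarrow>
     (\<exists>\<mu>. prob_space \<mu> \<and> sets \<mu> = sets (vec_space p) \<and>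
        D = distr (PiM {..<n} (\<lambda>_. \<mu>)) (design_space n p)
                  (\<lambda>R. \<lambda>ij\<in>{..<n} \<times> {..<p}. R (fst ij) (snd ij)) \<and>
        (\<forall>j<p. integrable \<mu> (\<lambda>x. x j) \<and> (\<integral>x. x j \<partial>\<mu>) = 0) \<and>
        (\<forall>j<p. \<forall>k<p. integrable \<mu> (\<lambda>x. x j * x k) \<and>
              (\<integral>x. x j * x k \<partial>\<mu>) = (if j = k then 1 else 0)) \<and>
        (\<forall>u::nat \<Rightarrow> real. (\<Sum>j<p. (u j)\<^sup>2) = 1 \<longrightarrow> (\<forall>t::real.
            integrable \<mu> (\<lambda>x. exp (t * (\<Sum>j<p. u j * x j))) \<and>
            ln (\<integral>x. exp (t * (\<Sum>j<p. u j * x j)) \<partial>\<mu>) \<le> \<sigma>2 * t\<^sup>2 / 2))) \<and>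
     (AE X in D. \<forall>v::nat \<Rightarrow> real. (\<exists>j<p. v j \<noteq> 0) \<longrightarrow>
         (\<Sum>j<p. \<Sum>k<p. v j * (\<Sum>i<n. X (i, j) * X (i, k)) * v k) > 0)"

text \<open>Design class O_n(p): X^T X = n I_p (almost surely; covers deterministic designs).\<close>
definition orth_design :: "nat \<Rightarrow> nat \<Rightarrow> (nat \<times> nat \<Rightarrow> real) measure \<Rightarrow> bool" where
  "orth_design n p D \<longleftrightarrow> prob_space D \<and> sets D = sets (design_space n p) \<and>
     (AE X in D. \<forall>j<p. \<forall>k<p. (\<Sum>i<n. X (i, j) * X (i, k)) = (if j = k then real n else 0))"

definition log_ratio :: "real \<Rightarrow> nat \<Rightarrow> ereal" where
  "log_ratio r p = (if 1 - r \<le> 0 then -\<infinity> else ereal (ln (1 - r) / ln (real p)))"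

end

theory Submission
  imports Defs
begin

text \<open>The test rejects for large values of the squared norm of the projection of y on the column space of
  X, through the clipped exponential statistic min 1 (w K exp (- t |Py|^2)) with t = p^(-1/2), K the
  inverse of the null Laplace transform, and w a small negative power of p. Its expectation is explicit,
  given X, under the null and under each alternative, and decreases with the noncentrality |X b|^2; this
  gives a gain of order w t n |b|^2, while clipping costs only w^m for arbitrarily large m.

  Conversely, a random sparse vector with independent random signs has second moment
  E exp <X b, X b'> under the null, where b' is an independent copy of b. For both design classes this is
  1 + O(p^(-2 delta)), because X^T X / n is close enough to the identity as soon as n >= p.\<close>

section \<open>Gaussian integrals\<close>

text \<open>Up to rounding of s, n s A^2 = p^(1/2 - \<delta>): \<alpha> cancels, and t n s A^2 =
  p^(-\<delta>) is the order of the relative drop of the Laplace transform of |Py|^2. The scale t =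
  p^(-1/2) matches the null standard deviation sqrt (2 p) of |Py|^2, and p t^2 = 1 keeps every fixed
  moment of the normalised statistic bounded in p. As the risk gap is polynomially small, errors
  have to be compared with p^(-\<delta>); an exact Laplace transform leaves only the clipping error.
  Monotonicity in |X b| matters because the alternatives have no upper bound on the signal: the
  weakest one decides. In the converse the second moment has two sources of excess. Coordinates
  shared by two draws contribute about s^2 (n A^2)^2 / p; the random signs remove their first-order
  effect, and \<alpha> \<le> 1/2 keeps n A^2 \<le> 1, so that the quadratic effect dominates. The
  deviation of X^T X from n I contributes about n (s A^2)^2 = p^(1 - 2 \<delta>) / n. For n \<ge> p
  both are of order at most p^(-2 \<delta>), and the risk gap is bounded by the square root.\<close>

abbreviation "std_normal \<equiv> density lborel std_normal_density"

lemma prob_space_std_normal: "prob_space std_normal"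
  by (intro prob_space_normal_density) simp

text \<open>Completing the square: tilting the standard normal density by exp (t g) gives exp (t^2 /
  2) times the density of N(t, 1), which has mass one.\<close>

lemma nn_integral_std_normal_exp:
  "(\<integral>\<^sup>+g. ennreal (exp (t * g)) \<partial>std_normal) = ennreal (exp (t\<^sup>2 / 2))"
proof -
  interpret prob_space "density lborel (normal_density t 1)"
    by (intro prob_space_normal_density) simp
  have "(\<integral>\<^sup>+g. ennreal (exp (t * g)) \<partial>std_normal)
      = (\<integral>\<^sup>+g. ennreal (exp (t\<^sup>2 / 2)) * ennreal (normal_density t 1 g) \<partial>lborel)"
    by (subst nn_integral_density)
       (auto intro!: nn_integral_cong
         simp: ennreal_mult[symmetric] normal_density_def exp_add[symmetric] power2_eq_square field_simps)
  also have "\<dots> = ennreal (exp (t\<^sup>2 / 2)) * emeasure (density lborel (normal_density t 1)) UNIV"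
    by (subst nn_integral_cmult) (auto simp: emeasure_density)
  finally show ?thesis
    using emeasure_space_1 by simp
qed

text \<open>Tilting by exp (g^2 / 4) doubles the variance. The exponent 1/4 stays below the critical
  value 1/2, and the constant sqrt 2 is what later bounds exponential moments of squares of
  sub-Gaussian variables by 2.\<close>

lemma nn_integral_std_normal_exp_square_quarter:
  "(\<integral>\<^sup>+g. ennreal (exp (g\<^sup>2 / 4)) \<partial>std_normal) = ennreal (sqrt 2)"
proof -
  interpret prob_space "density lborel (normal_density 0 (sqrt 2))"
    by (intro prob_space_normal_density) simp
  have "(\<integral>\<^sup>+g. ennreal (exp (g\<^sup>2 / 4)) \<partial>std_normal)
      = (\<integral>\<^sup>+g. ennreal (sqrt 2) * ennreal (normal_density 0 (sqrt 2) g) \<partial>lborel)"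
    by (subst nn_integral_density)
       (auto intro!: nn_integral_cong
         simp: ennreal_mult[symmetric] normal_density_def exp_add[symmetric] real_sqrt_mult field_simps)
  also have "\<dots> = ennreal (sqrt 2) * emeasure (density lborel (normal_density 0 (sqrt 2))) UNIV"
    by (subst nn_integral_cmult) (auto simp: emeasure_density)
  finally show ?thesis
    using emeasure_space_1 by simp
qed

lemma integral_std_normal_iexp:
  "(\<integral>g. iexp (t * g) \<partial>std_normal) = complex_of_real (exp (- (t\<^sup>2 / 2)))"
  using char_std_normal_distribution unfolding char_def fun_eq_iff by simp

text \<open>The factor exp (- \<theta> g^2) shrinks the variance to 1 / (1 + 2 \<theta>). After the
  rescaling x = c g what remains is the characteristic function of a standard normal variable at t /
  c.\<close>

lemma integral_std_normal_iexp_gauss: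
  assumes "0 \<le> \<theta>"
  shows "(\<integral>g. iexp (t * g) * complex_of_real (exp (- \<theta> * g\<^sup>2)) \<partial>std_normal)
       = complex_of_real ((1 + 2 * \<theta>) powr (- 1 / 2) * exp (- (t\<^sup>2 / (2 * (1 + 2 * \<theta>)))))"
proof -
  define c where "c = sqrt (1 + 2 * \<theta>)"
  have c: "c > 0" "c\<^sup>2 = 1 + 2 * \<theta>" using assms by (auto simp: c_def)
  have e: "(x / c)\<^sup>2 / 2 + \<theta> * (x / c)\<^sup>2 = x\<^sup>2 / 2" for x
  proof -
    have "(x / c)\<^sup>2 / 2 + \<theta> * (x / c)\<^sup>2 = (1 + 2 * \<theta>) * (x / c)\<^sup>2 / 2" by (simp add: algebra_simps)
    also have "\<dots> = x\<^sup>2 / 2" using c by (simp add: c(2)[symmetric] power_divide)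
    finally show ?thesis .
  qed
  have "(\<integral>g. iexp (t * g) * complex_of_real (exp (- \<theta> * g\<^sup>2)) \<partial>std_normal)
      = (\<integral>g. std_normal_density g *\<^sub>R (iexp (t * g) * complex_of_real (exp (- \<theta> * g\<^sup>2))) \<partial>lborel)"
    by (subst integral_density) (auto simp: normal_density_nonneg)
  also have "\<dots> = (1 / c) *\<^sub>R (\<integral>x. std_normal_density (x / c) *\<^sub>R (iexp (t * (x / c)) * complex_of_real (exp (- \<theta> * (x / c)\<^sup>2))) \<partial>lborel)"
    using c by (subst lborel_integral_real_affine[where c = "1 / c" and t = 0]) auto
  also have "(\<integral>x. std_normal_density (x / c) *\<^sub>R (iexp (t * (x / c)) * complex_of_real (exp (- \<theta> * (x / c)\<^sup>2))) \<partial>lborel)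
      = (\<integral>x. std_normal_density x *\<^sub>R iexp ((t / c) * x) \<partial>lborel)"
  proof (intro Bochner_Integration.integral_cong refl)
    fix x
    have "std_normal_density (x / c) * exp (- \<theta> * (x / c)\<^sup>2) = std_normal_density x"
      using e[of x] by (simp add: std_normal_density_def exp_add[symmetric] algebra_simps)
    then have "std_normal_density x *\<^sub>R iexp ((t / c) * x)
       = (std_normal_density (x / c) * exp (- \<theta> * (x / c)\<^sup>2)) *\<^sub>R iexp ((t / c) * x)" by simp
    then show "std_normal_density (x / c) *\<^sub>R (iexp (t * (x / c)) * complex_of_real (exp (- \<theta> * (x / c)\<^sup>2)))
        = std_normal_density x *\<^sub>R iexp ((t / c) * x)"
      by (simp add: scaleR_conv_of_real mult_ac)
  qed
  also have "\<dots> = (\<integral>g. iexp ((t / c) * g) \<partial>std_normal)"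
    by (subst integral_density) (auto simp: normal_density_nonneg)
  also have "\<dots> = complex_of_real (exp (- ((t / c)\<^sup>2 / 2)))"
    by (rule integral_std_normal_iexp)
  also have "(t / c)\<^sup>2 / 2 = t\<^sup>2 / (2 * (1 + 2 * \<theta>))"
    by (simp add: power_divide c(2))
  also have "1 / c = (1 + 2 * \<theta>) powr (- 1 / 2)"
    using assms by (simp add: c_def powr_minus_divide powr_half_sqrt)
  finally show ?thesis by (simp add: scaleR_conv_of_real)
qed

lemma product_sigma_finite_std_normal: "product_sigma_finite (\<lambda>_. std_normal)"
  unfolding product_sigma_finite_def
  using prob_space_std_normal prob_space_imp_sigma_finite by blast

lemma prob_space_gauss: "prob_space (gauss n)"
  unfolding gauss_def by (intro prob_space_PiM prob_space_std_normal)

lemma sets_gauss [measurable_cong, simp]: "sets (gauss n) = sets (vec_space n)"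
  unfolding gauss_def vec_space_def by (intro sets_PiM_cong) auto

lemma space_gauss [simp]: "space (gauss n) = space (vec_space n)"
  by (intro sets_eq_imp_space_eq sets_gauss)

lemma measurable_vec_space_component [measurable]:
  "i < n \<Longrightarrow> (\<lambda>x. x i) \<in> borel_measurable (vec_space n)"
  unfolding vec_space_def by (intro measurable_component_singleton) auto

lemma integral_gauss_iexp:
  "(\<integral>e. iexp (\<Sum>i<n. v i * e i) \<partial>gauss n) = complex_of_real (exp (- ((\<Sum>i<n. (v i)\<^sup>2) / 2)))"
proof -
  interpret product_sigma_finite "\<lambda>_::nat. std_normal" by (rule product_sigma_finite_std_normal)
  interpret N: prob_space std_normal by (rule prob_space_std_normal)
  have "(\<integral>e. iexp (\<Sum>i<n. v i * e i) \<partial>gauss n) = (\<integral>e. (\<Prod>i<n. iexp (v i * e i)) \<partial>gauss n)"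
    by (simp add: exp_sum[symmetric] sum_distrib_left)
  also have "\<dots> = (\<Prod>i<n. \<integral>g. iexp (v i * g) \<partial>std_normal)"
    unfolding gauss_def
    by (rule product_integral_prod) (auto intro!: N.integrable_const_bound[where B = 1])
  also have "\<dots> = complex_of_real (exp (\<Sum>i<n. - ((v i)\<^sup>2 / 2)))"
    unfolding integral_std_normal_iexp by (simp only: exp_sum finite_lessThan of_real_prod)
  finally show ?thesis by (simp add: sum_negf sum_divide_distrib)
qed

text \<open>Parseval's identity for an orthonormal family of p vectors in R^n.\<close>

lemma sum_square_orthonormal:
  fixes q :: "nat \<Rightarrow> nat \<Rightarrow> real"
  assumes "\<And>j k. j < p \<Longrightarrow> k < p \<Longrightarrow> (\<Sum>i<n. q j i * q k i) = (if j = k then 1 else 0)"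
  shows "(\<Sum>i<n. (\<Sum>j<p. c j * q j i)\<^sup>2) = (\<Sum>j<p. (c j)\<^sup>2)"
proof -
  have "(\<Sum>i<n. (\<Sum>j<p. c j * q j i)\<^sup>2) = (\<Sum>i<n. \<Sum>j<p. \<Sum>k<p. c j * c k * (q j i * q k i))"
    by (simp add: power2_eq_square sum_product algebra_simps)
  also have "\<dots> = (\<Sum>j<p. \<Sum>k<p. c j * c k * (\<Sum>i<n. q j i * q k i))"
    unfolding sum_distrib_left
    by (rule trans[OF sum.swap sum.cong[OF refl]], rule sum.swap)
  also have "\<dots> = (\<Sum>j<p. \<Sum>k<p. if j = k then c j * c k else 0)"
    by (intro sum.cong refl) (auto simp: assms)
  finally show ?thesis by (simp add: power2_eq_square)
qed

text \<open>Linearising the square, exp (- t z^2) = E exp (i sqrt (2 t) g z) with g standard normal,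
  reduces the joint law of the projections to a single characteristic function.\<close>

lemma gauss_laplace_orthonormal:
  fixes q :: "nat \<Rightarrow> nat \<Rightarrow> real"
  assumes q: "\<And>j k. j < p \<Longrightarrow> k < p \<Longrightarrow> (\<Sum>i<n. q j i * q k i) = (if j = k then 1 else 0)"
    and \<theta>: "0 \<le> \<theta>"
  shows "(\<integral>e. exp (- \<theta> * (\<Sum>j<p. (a j + (\<Sum>i<n. q j i * e i))\<^sup>2)) \<partial>gauss n)
       = (1 + 2 * \<theta>) powr (- real p / 2) * exp (- (\<theta> / (1 + 2 * \<theta>)) * (\<Sum>j<p. (a j)\<^sup>2))"
proof -
  define s where "s = sqrt (2 * \<theta>)"
  have s2: "s\<^sup>2 = 2 * \<theta>" using \<theta> by (simp add: s_def)
  interpret product_sigma_finite "\<lambda>_::nat. std_normal" by (rule product_sigma_finite_std_normal)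
  interpret N: prob_space std_normal by (rule prob_space_std_normal)
  interpret Gn: prob_space "gauss n" by (rule prob_space_gauss)
  interpret Gp: prob_space "gauss p" by (rule prob_space_gauss)
  interpret P: pair_prob_space "gauss n" "gauss p" ..
  define z where "z e j = a j + (\<Sum>i<n. q j i * e i)" for e :: "nat \<Rightarrow> real" and j
  have z_meas [measurable]: "(\<lambda>e. z e j) \<in> borel_measurable (vec_space n)" for j
    unfolding z_def by measurable
  have lin: "complex_of_real (exp (- \<theta> * (\<Sum>j<p. (z e j)\<^sup>2))) = (\<integral>g. iexp (\<Sum>j<p. (s * z e j) * g j) \<partial>gauss p)" for e
    by (subst integral_gauss_iexp) (simp add: power_mult_distrib s2 sum_distrib_left sum_negf sum_divide_distrib mult.assoc)
  \<comment> \<open>For fixed g the exponent is affine in e. The coefficient vector of its linear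
    part is s times the combination of the q j with weights g j; by orthonormality its squared norm
    is s^2 |g|^2, so the result factorises over j.\<close>
  have inner: "(\<integral>e. iexp (\<Sum>j<p. (s * z e j) * g j) \<partial>gauss n)
      = (\<Prod>j<p. iexp (s * a j * g j) * complex_of_real (exp (- \<theta> * (g j)\<^sup>2)))" for g
  proof -
    have 1: "(\<Sum>j<p. (s * z e j) * g j) = (\<Sum>j<p. s * a j * g j) + (\<Sum>i<n. (\<Sum>j<p. (s * g j) * q j i) * e i)" for e
    proof -
      have "(\<Sum>i<n. (\<Sum>j<p. (s * g j) * q j i) * e i) = (\<Sum>j<p. \<Sum>i<n. s * g j * (q j i * e i))"
        unfolding sum_distrib_right by (subst sum.swap) (simp add: mult.assoc)
      then show ?thesis
        by (simp add: z_def algebra_simps sum.distrib sum_distrib_left)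
    qed
    have "(\<integral>e. iexp (\<Sum>j<p. (s * z e j) * g j) \<partial>gauss n)
        = iexp (\<Sum>j<p. s * a j * g j) * (\<integral>e. iexp (\<Sum>i<n. (\<Sum>j<p. (s * g j) * q j i) * e i) \<partial>gauss n)"
      unfolding 1 by (simp add: distrib_left exp_add)
    also have "\<dots> = iexp (\<Sum>j<p. s * a j * g j) * complex_of_real (exp (- ((\<Sum>j<p. (s * g j)\<^sup>2) / 2)))"
      by (subst integral_gauss_iexp) (simp add: sum_square_orthonormal[OF q])
    also have "(\<Sum>j<p. (s * g j)\<^sup>2) / 2 = (\<Sum>j<p. \<theta> * (g j)\<^sup>2)"
      by (simp add: power_mult_distrib s2 sum_divide_distrib)
    finally show ?thesis
      by (simp add: prod.distrib exp_sum sum_distrib_left sum_negf[symmetric] of_real_sum flip: exp_of_real)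
  qed
  \<comment> \<open>The integrand has modulus one, so finiteness of the two measures is all that the
    exchange of integrals requires.\<close>
  have int: "integrable (gauss n \<Otimes>\<^sub>M gauss p) (\<lambda>(e, g). iexp (\<Sum>j<p. (s * z e j) * g j))"
    by (rule P.integrable_const_bound[where B = 1]) (auto simp: split_beta)
  have "complex_of_real (\<integral>e. exp (- \<theta> * (\<Sum>j<p. (z e j)\<^sup>2)) \<partial>gauss n)
      = (\<integral>e. (\<integral>g. iexp (\<Sum>j<p. (s * z e j) * g j) \<partial>gauss p) \<partial>gauss n)"
    by (simp only: lin[symmetric] integral_complex_of_real)
  also have "\<dots> = (\<integral>g. (\<integral>e. iexp (\<Sum>j<p. (s * z e j) * g j) \<partial>gauss n) \<partial>gauss p)"
    using P.Fubini_integral[OF int] by simp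
  also have "\<dots> = (\<integral>g. (\<Prod>j<p. iexp (s * a j * g j) * complex_of_real (exp (- \<theta> * (g j)\<^sup>2))) \<partial>gauss p)"
    unfolding inner ..
  also have "\<dots> = (\<Prod>j<p. \<integral>x. iexp (s * a j * x) * complex_of_real (exp (- \<theta> * x\<^sup>2)) \<partial>std_normal)"
    unfolding gauss_def
    by (rule product_integral_prod)
       (use \<theta> in \<open>auto intro!: N.integrable_const_bound[where B = 1] simp: norm_mult\<close>)
  also have "\<dots> = (\<Prod>j<p. complex_of_real ((1 + 2 * \<theta>) powr (- 1 / 2) * exp (- ((s * a j)\<^sup>2 / (2 * (1 + 2 * \<theta>))))))"
    unfolding integral_std_normal_iexp_gauss[OF \<theta>] ..
  also have "\<dots> = complex_of_real (\<Prod>j<p. (1 + 2 * \<theta>) powr (- 1 / 2) * exp (- (\<theta> / (1 + 2 * \<theta>)) * (a j)\<^sup>2))"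
  proof -
    have "(s * a j)\<^sup>2 / (2 * (1 + 2 * \<theta>)) = \<theta> / (1 + 2 * \<theta>) * (a j)\<^sup>2" for j
      using \<theta> by (simp add: power_mult_distrib s2 divide_simps)
    then show ?thesis by simp
  qed
  also have "(\<Prod>j<p. (1 + 2 * \<theta>) powr (- 1 / 2) * exp (- (\<theta> / (1 + 2 * \<theta>)) * (a j)\<^sup>2))
      = (1 + 2 * \<theta>) powr (- real p / 2) * exp (- (\<theta> / (1 + 2 * \<theta>)) * (\<Sum>j<p. (a j)\<^sup>2))"
  proof -
    have "((1 + 2 * \<theta>) powr (- 1 / 2)) ^ p = (1 + 2 * \<theta>) powr (- real p / 2)"
      using \<theta> by (simp add: powr_realpow[symmetric] powr_powr)
    then show ?thesis by (simp add: prod.distrib exp_sum[symmetric] sum_distrib_left)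
  qed
  finally show ?thesis unfolding of_real_eq_iff z_def .
qed

section \<open>Gaussian shifts as a change of measure\<close>

lemma measurable_shift_vec_space:
  "(\<lambda>e. \<lambda>i\<in>{..<n}. \<mu> i + e i) \<in> measurable (vec_space n) (vec_space n)"
  unfolding vec_space_def by measurable

text \<open>The Cameron-Martin formula in finite dimension. Both sides are identified with the
  product of the laws N(\<mu> i, 1) by evaluating them on boxes, which reduces the claim to
  one-dimensional densities.\<close>

lemma distr_gauss_shift:
  "distr (gauss n) (vec_space n) (\<lambda>e. \<lambda>i\<in>{..<n}. \<mu> i + e i)
     = density (gauss n) (\<lambda>e. ennreal (exp ((\<Sum>i<n. \<mu> i * e i) - (\<Sum>i<n. (\<mu> i)\<^sup>2) / 2)))" (is "?L = ?R")
proof -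
  define M where "M i = density lborel (normal_density (\<mu> i) 1)" for i
  have prob_M: "prob_space (M i)" for i
    unfolding M_def by (intro prob_space_normal_density) simp
  interpret M: product_sigma_finite M
    unfolding product_sigma_finite_def using prob_M prob_space_imp_sigma_finite by blast
  interpret N: product_sigma_finite "\<lambda>_::nat. std_normal" by (rule product_sigma_finite_std_normal)
  have sM: "sets (PiM {..<n} M) = sets (vec_space n)"
    unfolding vec_space_def M_def by (intro sets_PiM_cong) auto
  have [measurable]: "(\<lambda>e. \<lambda>i\<in>{..<n}. \<mu> i + e i) \<in> measurable (gauss n) (vec_space n)"
    using measurable_shift_vec_space by (simp cong: measurable_cong_sets)
  have "?L = PiM {..<n} M"
  proof (rule M.PiM_eqI)
    fix A assume A: "\<And>i. i \<in> {..<n} \<Longrightarrow> A i \<in> sets (M i)"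
    then have A': "\<And>i. i < n \<Longrightarrow> A i \<in> sets borel" by (simp add: M_def)
    have *: "(\<lambda>x. \<mu> i + x) -` A i \<in> sets borel" if "i < n" for i
      using measurable_sets[of "(\<lambda>x. \<mu> i + x)" borel borel, OF _ A'[OF that]] by simp
    have pre: "(\<lambda>e. \<lambda>i\<in>{..<n}. \<mu> i + e i) -` PiE {..<n} A \<inter> space (gauss n)
        = PiE {..<n} (\<lambda>i. (\<lambda>x. \<mu> i + x) -` A i)"
      unfolding space_gauss by (auto simp: vec_space_def space_PiM PiE_iff)
    have "emeasure ?L (PiE {..<n} A) = emeasure (gauss n) (PiE {..<n} (\<lambda>i. (\<lambda>x. \<mu> i + x) -` A i))"
      unfolding pre[symmetric] using A'
      by (intro emeasure_distr) (auto simp: vec_space_def intro!: sets_PiM_I_finite)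
    also have "\<dots> = (\<Prod>i<n. emeasure std_normal ((\<lambda>x. \<mu> i + x) -` A i))"
      unfolding gauss_def using * by (intro N.emeasure_PiM) auto
    also have "\<dots> = (\<Prod>i<n. emeasure (M i) (A i))"
    proof (intro prod.cong refl)
      fix i assume "i \<in> {..<n}"
      then have i: "i < n" by simp
      have "emeasure (M i) (A i) = (\<integral>\<^sup>+x. ennreal (normal_density (\<mu> i) 1 x) * indicator (A i) x \<partial>lborel)"
        unfolding M_def using A'[OF i] by (simp add: emeasure_density)
      also have "\<dots> = (\<integral>\<^sup>+x. ennreal (normal_density (\<mu> i) 1 (\<mu> i + 1 * x)) * indicator (A i) (\<mu> i + 1 * x) \<partial>lborel)"
        using A'[OF i] by (subst nn_integral_real_affine[where c = 1 and t = "\<mu> i"]) auto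
      also have "\<dots> = (\<integral>\<^sup>+x. ennreal (std_normal_density x) * indicator ((\<lambda>x. \<mu> i + x) -` A i) x \<partial>lborel)"
        by (intro nn_integral_cong) (auto simp: normal_density_def indicator_def)
      also have "\<dots> = emeasure std_normal ((\<lambda>x. \<mu> i + x) -` A i)"
        using *[OF i] by (simp add: emeasure_density)
      finally show "emeasure std_normal ((\<lambda>x. \<mu> i + x) -` A i) = emeasure (M i) (A i)" ..
    qed
    finally show "emeasure ?L (PiE {..<n} A) = (\<Prod>i\<in>{..<n}. emeasure (M i) (A i))" .
  qed (auto simp: sM)
  moreover have "?R = PiM {..<n} M"
  proof (rule M.PiM_eqI)
    fix A assume A: "\<And>i. i \<in> {..<n} \<Longrightarrow> A i \<in> sets (M i)"
    then have A': "\<And>i. i < n \<Longrightarrow> A i \<in> sets borel" by (simp add: M_def)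
    have sA: "PiE {..<n} A \<in> sets (vec_space n)"
      unfolding vec_space_def using A' by (intro sets_PiM_I_finite) auto
    have "emeasure ?R (PiE {..<n} A) = (\<integral>\<^sup>+e. ennreal (exp ((\<Sum>i<n. \<mu> i * e i) - (\<Sum>i<n. (\<mu> i)\<^sup>2) / 2)) * indicator (PiE {..<n} A) e \<partial>gauss n)"
      using sA by (subst emeasure_density) auto
    also have "\<dots> = (\<integral>\<^sup>+e. (\<Prod>i<n. ennreal (exp (\<mu> i * e i - (\<mu> i)\<^sup>2 / 2)) * indicator (A i) (e i)) \<partial>gauss n)"
    proof (intro nn_integral_cong)
      fix e assume "e \<in> space (gauss n)"
      \<comment> \<open>The indicator of the box factorises over the coordinates only for
        extensional e.\<close>
      then have e: "e \<in> extensional {..<n}" by (auto simp: vec_space_def space_PiM PiE_iff)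
      have "exp ((\<Sum>i<n. \<mu> i * e i) - (\<Sum>i<n. (\<mu> i)\<^sup>2) / 2) = (\<Prod>i<n. exp (\<mu> i * e i - (\<mu> i)\<^sup>2 / 2))"
        by (simp add: exp_sum[symmetric] sum_subtractf sum_divide_distrib)
      moreover have "indicator (PiE {..<n} A) e = (\<Prod>i<n. indicator (A i) (e i) :: ennreal)"
        using e by (auto simp: indicator_def PiE_iff)
      ultimately show "ennreal (exp ((\<Sum>i<n. \<mu> i * e i) - (\<Sum>i<n. (\<mu> i)\<^sup>2) / 2)) * indicator (PiE {..<n} A) e
          = (\<Prod>i<n. ennreal (exp (\<mu> i * e i - (\<mu> i)\<^sup>2 / 2)) * indicator (A i) (e i))"
        by (simp add: prod.distrib prod_ennreal)
    qed
    also have "\<dots> = (\<Prod>i<n. \<integral>\<^sup>+x. ennreal (exp (\<mu> i * x - (\<mu> i)\<^sup>2 / 2)) * indicator (A i) x \<partial>std_normal)"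
      unfolding gauss_def using A' by (intro N.product_nn_integral_prod) auto
    also have "\<dots> = (\<Prod>i<n. emeasure (M i) (A i))"
    proof (intro prod.cong refl)
      fix i assume "i \<in> {..<n}"
      then have i: "i < n" by simp
      have d: "std_normal_density x * exp (\<mu> i * x - (\<mu> i)\<^sup>2 / 2) = normal_density (\<mu> i) 1 x" for x
      proof -
        have "- x\<^sup>2 / 2 + (\<mu> i * x - (\<mu> i)\<^sup>2 / 2) = - (x - \<mu> i)\<^sup>2 / 2"
          by (simp add: power2_eq_square field_simps)
        then show ?thesis by (simp add: normal_density_def exp_add[symmetric])
      qed
      have "(\<integral>\<^sup>+x. ennreal (exp (\<mu> i * x - (\<mu> i)\<^sup>2 / 2)) * indicator (A i) x \<partial>std_normal)
          = (\<integral>\<^sup>+x. ennreal (std_normal_density x) * (ennreal (exp (\<mu> i * x - (\<mu> i)\<^sup>2 / 2)) * indicator (A i) x) \<partial>lborel)"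
        using A'[OF i] by (subst nn_integral_density) auto
      also have "\<dots> = (\<integral>\<^sup>+x. ennreal (normal_density (\<mu> i) 1 x) * indicator (A i) x \<partial>lborel)"
        by (simp add: d[symmetric] ennreal_mult mult.assoc)
      also have "\<dots> = emeasure (M i) (A i)"
        unfolding M_def using A'[OF i] by (simp add: emeasure_density)
      finally show "(\<integral>\<^sup>+x. ennreal (exp (\<mu> i * x - (\<mu> i)\<^sup>2 / 2)) * indicator (A i) x \<partial>std_normal) = emeasure (M i) (A i)" .
    qed
    finally show "emeasure ?R (PiE {..<n} A) = (\<Prod>i\<in>{..<n}. emeasure (M i) (A i))" .
  qed (auto simp: sM)
  ultimately show ?thesis by simp
qed

section \<open>Gram-Schmidt orthonormalisation of the columns\<close>

text \<open>Makes the bound l < k of the inner sum available to the termination proof of the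
  recursion that follows.\<close>

declare sum.cong [fundef_cong]

text \<open>An explicit recursion, so that the basis of the column space, and hence the test, is
  visibly measurable in X. \<open>gram_schmidt n X k i\<close> is coordinate i of the k-th vector.
  If the residual vanishes, division by zero returns 0, which keeps the function total on
  rank-deficient matrices; these have probability zero.\<close>

fun gram_schmidt :: "nat \<Rightarrow> (nat \<times> nat \<Rightarrow> real) \<Rightarrow> nat \<Rightarrow> nat \<Rightarrow> real" where
  "gram_schmidt n X k =
     (let r = (\<lambda>i. X (i, k) - (\<Sum>l<k. (\<Sum>h<n. gram_schmidt n X l h * X (h, k)) * gram_schmidt n X l i))
      in (\<lambda>i. r i / sqrt (\<Sum>h<n. (r h)\<^sup>2)))"

declare gram_schmidt.simps [simp del]

definition gs_residual :: "nat \<Rightarrow> (nat \<times> nat \<Rightarrow> real) \<Rightarrow> nat \<Rightarrow> nat \<Rightarrow> real" where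
  "gs_residual n X k i =
     X (i, k) - (\<Sum>l<k. (\<Sum>h<n. gram_schmidt n X l h * X (h, k)) * gram_schmidt n X l i)"

lemma gram_schmidt_eq:
  "gram_schmidt n X k i = gs_residual n X k i / sqrt (\<Sum>h<n. (gs_residual n X k h)\<^sup>2)"
  by (subst gram_schmidt.simps) (simp add: Let_def gs_residual_def)

lemma measurable_design_component [measurable]:
  "i < n \<Longrightarrow> j < p \<Longrightarrow> (\<lambda>X. X (i, j)) \<in> borel_measurable (design_space n p)"
  unfolding design_space_def by (intro measurable_component_singleton) auto

lemma measurable_gram_schmidt:
  "k < p \<Longrightarrow> i < n \<Longrightarrow> (\<lambda>X. gram_schmidt n X k i) \<in> borel_measurable (design_space n p)"
proof (induction k arbitrary: i rule: less_induct)
  case (less k)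
  have [measurable]: "(\<lambda>X. gram_schmidt n X l i) \<in> borel_measurable (design_space n p)" if "l < k" "i < n" for l i
    using less.IH[OF that(1)] that less.prems by auto
  have [measurable]: "(\<lambda>X. gs_residual n X k i) \<in> borel_measurable (design_space n p)" if "i < n" for i
    unfolding gs_residual_def using that less.prems by measurable
  show ?case unfolding gram_schmidt_eq using less.prems by measurable
qed

text \<open>The change of basis is triangular with unit diagonal: earlier vectors do not involve
  column k, so its coefficient stays 1. The residual is therefore X v with v nonzero, and full
  column rank makes it nonzero.\<close>

lemma gs_residual_in_span:
  assumes "k < p"
  shows "\<exists>v. v k = 1 \<and> (\<forall>j>k. v j = 0) \<and> (\<forall>i. gs_residual n X k i = (\<Sum>j<p. X (i, j) * v j))"
  using assms
proof (induction k rule: less_induct)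
  case (less k)
  have "\<exists>c. (\<forall>j>l. c j = 0) \<and> (\<forall>i. gram_schmidt n X l i = (\<Sum>j<p. X (i, j) * c j))" if l: "l < k" for l
  proof -
    obtain v where v: "\<forall>j>l. v j = 0" "\<forall>i. gs_residual n X l i = (\<Sum>j<p. X (i, j) * v j)"
      using less.IH[OF l] l less.prems by auto
    then show ?thesis
      by (intro exI[of _ "\<lambda>j. v j / sqrt (\<Sum>h<n. (gs_residual n X l h)\<^sup>2)"])
         (auto simp: gram_schmidt_eq sum_divide_distrib)
  qed
  then obtain c where c: "\<And>l j. l < k \<Longrightarrow> j > l \<Longrightarrow> c l j = 0"
    "\<And>l i. l < k \<Longrightarrow> gram_schmidt n X l i = (\<Sum>j<p. X (i, j) * c l j)"
    by metis
  define a where "a l = (\<Sum>h<n. gram_schmidt n X l h * X (h, k))" for l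
  define v where "v j = (if j = k then 1 else 0) - (\<Sum>l<k. a l * c l j)" for j
  have "gs_residual n X k i = (\<Sum>j<p. X (i, j) * v j)" for i
  proof -
    have "(\<Sum>l<k. a l * gram_schmidt n X l i) = (\<Sum>l<k. \<Sum>j<p. a l * (X (i, j) * c l j))"
      by (intro sum.cong refl) (simp add: c sum_distrib_left)
    also have "\<dots> = (\<Sum>j<p. X (i, j) * (\<Sum>l<k. a l * c l j))"
      by (subst sum.swap) (simp add: sum_distrib_left mult_ac)
    finally have "gs_residual n X k i = X (i, k) - (\<Sum>j<p. X (i, j) * (\<Sum>l<k. a l * c l j))"
      by (simp add: gs_residual_def a_def)
    also have "X (i, k) = (\<Sum>j<p. X (i, j) * (if j = k then 1 else 0))"
      using less.prems by (simp add: if_distrib[of "times _"] cong: if_cong)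
    finally show ?thesis
      by (simp add: v_def right_diff_distrib sum_subtractf)
  qed
  moreover have "v k = 1" "\<forall>j>k. v j = 0" using c(1) by (auto simp: v_def)
  ultimately show ?case by blast
qed

context
  fixes n p :: nat and X :: "nat \<times> nat \<Rightarrow> real"
  assumes pos_def: "\<And>v. \<exists>j<p. v j \<noteq> 0 \<Longrightarrow> 0 < (\<Sum>i<n. (\<Sum>j<p. X (i, j) * v j)\<^sup>2)"
begin

lemma gs_residual_norm_pos:
  assumes "k < p" shows "0 < (\<Sum>i<n. (gs_residual n X k i)\<^sup>2)"
proof -
  obtain v where v: "v k = 1" "\<And>i. gs_residual n X k i = (\<Sum>j<p. X (i, j) * v j)"
    using gs_residual_in_span[OF assms] by metis
  show ?thesis unfolding v(2) using v(1) assms by (intro pos_def) (auto intro!: exI[of _ k])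
qed

lemma gram_schmidt_unit:
  assumes "k < p" shows "(\<Sum>i<n. gram_schmidt n X k i * gram_schmidt n X k i) = 1"
proof -
  have "(\<Sum>i<n. gram_schmidt n X k i * gram_schmidt n X k i)
      = (\<Sum>i<n. (gs_residual n X k i)\<^sup>2) / (\<Sum>i<n. (gs_residual n X k i)\<^sup>2)"
    by (simp add: gram_schmidt_eq sum_divide_distrib[symmetric] power2_eq_square[symmetric] power_divide sum_nonneg)
  then show ?thesis using gs_residual_norm_pos[OF assms] by simp
qed

lemma gram_schmidt_orthonormal:
  assumes "j < p" "k < p"
  shows "(\<Sum>i<n. gram_schmidt n X j i * gram_schmidt n X k i) = (if j = k then 1 else 0)"
proof -
  \<comment> \<open>Induction on the larger index. Products of two vectors below k come from the
    induction hypothesis, in whichever order applies, or from normalisation; then the subtracted sum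
    cancels the projection of column k on vector j.\<close>
  have orth: "(\<Sum>i<n. gram_schmidt n X j i * gram_schmidt n X k i) = 0" if "j < k" "k < p" for j k
    using that
  proof (induction k arbitrary: j rule: less_induct)
    case (less k)
    define a where "a l = (\<Sum>h<n. gram_schmidt n X l h * X (h, k))" for l
    have ip: "(\<Sum>i<n. gram_schmidt n X j i * gram_schmidt n X l i) = (if j = l then 1 else 0)" if "l < k" for l
    proof (cases l j rule: linorder_cases)
      case less': less
      then show ?thesis using less.IH[of j l] less.prems by (simp add: mult.commute)
    next
      case equal
      then show ?thesis using gram_schmidt_unit[of j] less.prems by auto
    next
      case greater
      then show ?thesis using less.IH[of l j] less.prems that by auto
    qed
    have "(\<Sum>i<n. gram_schmidt n X j i * gs_residual n X k i)
        = a j - (\<Sum>i<n. \<Sum>l<k. a l * (gram_schmidt n X j i * gram_schmidt n X l i))"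
      by (simp add: gs_residual_def a_def right_diff_distrib sum_subtractf sum_distrib_left mult_ac)
    also have "(\<Sum>i<n. \<Sum>l<k. a l * (gram_schmidt n X j i * gram_schmidt n X l i))
        = (\<Sum>l<k. a l * (\<Sum>i<n. gram_schmidt n X j i * gram_schmidt n X l i))"
      by (subst sum.swap) (simp add: sum_distrib_left)
    also have "\<dots> = (\<Sum>l<k. if j = l then a l else 0)"
      by (intro sum.cong refl) (simp add: ip)
    also have "\<dots> = a j" using less.prems by simp
    finally have "(\<Sum>i<n. gram_schmidt n X j i * gs_residual n X k i) = 0" by simp
    then show ?case
      unfolding gram_schmidt_eq[of n X k] by (simp add: sum_divide_distrib[symmetric])
  qed
  show ?thesis
  proof (cases j k rule: linorder_cases)
    case less
    then show ?thesis using orth assms by simp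
  next
    case equal
    then show ?thesis using gram_schmidt_unit assms by simp
  next
    case greater
    then show ?thesis using orth[of k j] assms by (simp add: mult.commute)
  qed
qed

text \<open>Reads the recursion backwards, as in a QR factorisation: column k is its residual norm
  times vector k plus its projections on the earlier vectors.\<close>

lemma gram_schmidt_spans_column:
  assumes "k < p" shows "\<exists>b. \<forall>i. X (i, k) = (\<Sum>l<p. b l * gram_schmidt n X l i)"
proof -
  define N where "N = sqrt (\<Sum>h<n. (gs_residual n X k h)\<^sup>2)"
  define a where "a l = (\<Sum>h<n. gram_schmidt n X l h * X (h, k))" for l
  define b where "b l = (if l = k then N else if l < k then a l else 0)" for l
  have "N > 0" using gs_residual_norm_pos[OF assms] by (simp add: N_def)
  then have "X (i, k) = N * gram_schmidt n X k i + (\<Sum>l<k. a l * gram_schmidt n X l i)" for i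
    unfolding gram_schmidt_eq[of n X k] N_def[symmetric] by (simp add: gs_residual_def a_def)
  moreover have "(\<Sum>l<p. b l * gram_schmidt n X l i) = N * gram_schmidt n X k i + (\<Sum>l<k. a l * gram_schmidt n X l i)" for i
  proof -
    have "(\<Sum>l<p. b l * gram_schmidt n X l i) = (\<Sum>l<Suc k. b l * gram_schmidt n X l i)"
      using assms by (intro sum.mono_neutral_right) (auto simp: b_def)
    also have "\<dots> = N * gram_schmidt n X k i + (\<Sum>l<k. a l * gram_schmidt n X l i)"
      by (simp add: b_def)
    finally show ?thesis .
  qed
  ultimately show ?thesis by metis
qed

text \<open>X \<beta> lies in the span of the orthonormal family, so projecting it loses no length.
  This makes |X \<beta>|^2 the noncentrality of the projected statistic.\<close>

lemma sum_square_gram_schmidt_coords: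
  "(\<Sum>j<p. (\<Sum>i<n. gram_schmidt n X j i * (\<Sum>k<p. X (i, k) * \<beta> k))\<^sup>2) = (\<Sum>i<n. (\<Sum>k<p. X (i, k) * \<beta> k)\<^sup>2)"
proof -
  obtain b where b: "\<And>k i. k < p \<Longrightarrow> X (i, k) = (\<Sum>l<p. b k l * gram_schmidt n X l i)"
    using gram_schmidt_spans_column by metis
  define c where "c l = (\<Sum>k<p. \<beta> k * b k l)" for l
  have u: "(\<Sum>k<p. X (i, k) * \<beta> k) = (\<Sum>l<p. c l * gram_schmidt n X l i)" for i
  proof -
    have "(\<Sum>k<p. X (i, k) * \<beta> k) = (\<Sum>k<p. \<Sum>l<p. \<beta> k * b k l * gram_schmidt n X l i)"
      by (intro sum.cong refl) (simp add: b sum_distrib_left mult_ac)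
    also have "\<dots> = (\<Sum>l<p. c l * gram_schmidt n X l i)"
      unfolding c_def sum_distrib_right by (rule sum.swap)
    finally show ?thesis .
  qed
  have "(\<Sum>i<n. gram_schmidt n X j i * (\<Sum>l<p. c l * gram_schmidt n X l i)) = c j" if j: "j < p" for j
  proof -
    have "(\<Sum>i<n. gram_schmidt n X j i * (\<Sum>l<p. c l * gram_schmidt n X l i))
        = (\<Sum>l<p. c l * (\<Sum>i<n. gram_schmidt n X j i * gram_schmidt n X l i))"
      unfolding sum_distrib_left by (subst sum.swap) (simp add: mult_ac)
    also have "\<dots> = (\<Sum>l<p. if j = l then c l else 0)"
      using j by (intro sum.cong refl) (simp add: gram_schmidt_orthonormal)
    finally show ?thesis using j by simp
  qed
  then show ?thesis
    unfolding u by (simp add: sum_square_orthonormal[OF gram_schmidt_orthonormal])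
qed

end

section \<open>An upper bound on the minimax risk\<close>

abbreviation obs_map :: "nat \<Rightarrow> nat \<Rightarrow> (nat \<Rightarrow> real) \<Rightarrow> (nat \<times> nat \<Rightarrow> real) \<Rightarrow> (nat \<Rightarrow> real) \<Rightarrow> nat \<Rightarrow> real" where
  "obs_map n p \<beta> X e \<equiv> (\<lambda>i\<in>{..<n}. (\<Sum>j<p. X (i, j) * \<beta> j) + e i)"

locale design =
  fixes D :: "(nat \<times> nat \<Rightarrow> real) measure" and n p :: nat
  assumes prob_D: "prob_space D" and sets_D [measurable_cong, simp]: "sets D = sets (design_space n p)"
begin

sublocale D: prob_space D by (rule prob_D)
sublocale G: prob_space "gauss n" by (rule prob_space_gauss)
sublocale P: pair_prob_space D "gauss n" ..

lemma space_D [simp]: "space D = space (design_space n p)"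
  by (intro sets_eq_imp_space_eq sets_D)

lemma measurable_obs_map [measurable]:
  "(\<lambda>(X, e). obs_map n p \<beta> X e) \<in> measurable (D \<Otimes>\<^sub>M gauss n) (vec_space n)"
proof -
  have "(\<lambda>(X, e). obs_map n p \<beta> X e) \<in> measurable (D \<Otimes>\<^sub>M gauss n) (PiM {..<n} (\<lambda>_. borel))"
    unfolding split_beta' by (rule measurable_restrict) measurable
  then show ?thesis by (simp add: vec_space_def)
qed

lemma measurable_obs [measurable]:
  "(\<lambda>(X, e). (obs_map n p \<beta> X e, X)) \<in> measurable (D \<Otimes>\<^sub>M gauss n) (obs_space n p)"
  using measurable_obs_map[of \<beta>] unfolding obs_space_def split_beta'
  by (intro measurable_Pair) (auto intro: measurable_fst'')

lemma prob_space_obs_law: "prob_space (obs_law D n p \<beta>)"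
  unfolding obs_law_def by (rule P.prob_space_distr[OF measurable_obs])

lemma test_measurable_comp:
  assumes "T \<in> tests n p"
  shows "(\<lambda>x. T (obs_map n p \<beta> (fst x) (snd x), fst x)) \<in> borel_measurable (D \<Otimes>\<^sub>M gauss n)"
proof -
  have "T \<in> borel_measurable (obs_space n p)" using assms by (simp add: tests_def)
  from measurable_compose[OF measurable_obs[of \<beta>] this] show ?thesis by (simp add: case_prod_beta)
qed

lemma test_range:
  assumes "T \<in> tests n p" "X \<in> space D" "y \<in> space (vec_space n)"
  shows "0 \<le> T (y, X)" "T (y, X) \<le> 1"
  using assms by (auto simp: tests_def obs_space_def space_pair_measure)

lemma obs_map_in_space [simp]: "obs_map n p \<beta> X e \<in> space (vec_space n)"
  by (auto simp: vec_space_def space_PiM)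

lemma integrable_test:
  assumes "T \<in> tests n p"
  shows "integrable (D \<Otimes>\<^sub>M gauss n) (\<lambda>x. T (obs_map n p \<beta> (fst x) (snd x), fst x))"
  using assms test_measurable_comp
  by (intro P.integrable_const_bound[where B = 1]) (auto simp: space_pair_measure test_range)

lemma integral_obs_law:
  assumes "T \<in> tests n p"
  shows "(\<integral>\<omega>. T \<omega> \<partial>obs_law D n p \<beta>) = (\<integral>X. (\<integral>e. T (obs_map n p \<beta> X e, X) \<partial>gauss n) \<partial>D)"
proof -
  have "(\<integral>\<omega>. T \<omega> \<partial>obs_law D n p \<beta>) = (\<integral>x. T (obs_map n p \<beta> (fst x) (snd x), fst x) \<partial>(D \<Otimes>\<^sub>M gauss n))"
    unfolding obs_law_def using assms
    by (subst integral_distr[OF measurable_obs]) (auto simp: tests_def split_beta')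
  then show ?thesis
    using P.integral_fst'[OF integrable_test[OF assms]] by simp
qed

lemma one_minus_test: "T \<in> tests n p \<Longrightarrow> (\<lambda>\<omega>. 1 - T \<omega>) \<in> tests n p"
  by (auto simp: tests_def)

lemma integral_obs_law_range:
  assumes "T \<in> tests n p"
  shows "0 \<le> (\<integral>\<omega>. T \<omega> \<partial>obs_law D n p \<beta>)" "(\<integral>\<omega>. T \<omega> \<partial>obs_law D n p \<beta>) \<le> 1"
proof -
  interpret O: prob_space "obs_law D n p \<beta>" by (rule prob_space_obs_law)
  have T: "0 \<le> T \<omega>" "T \<omega> \<le> 1" if "\<omega> \<in> space (obs_law D n p \<beta>)" for \<omega>
    using that assms by (auto simp: tests_def obs_law_def)
  show "0 \<le> (\<integral>\<omega>. T \<omega> \<partial>obs_law D n p \<beta>)"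
    by (intro integral_nonneg_AE) (auto simp: T)
  have "integrable (obs_law D n p \<beta>) T"
    using assms by (intro O.integrable_const_bound[where B = 1]) (auto simp: T tests_def obs_law_def)
  then show "(\<integral>\<omega>. T \<omega> \<partial>obs_law D n p \<beta>) \<le> 1"
    by (intro O.integral_le_const) (auto simp: T)
qed

lemma integrable_obs_law:
  assumes "T \<in> tests n p"
  shows "integrable (obs_law D n p \<beta>) T"
proof -
  interpret O: prob_space "obs_law D n p \<beta>" by (rule prob_space_obs_law)
  show ?thesis
    using assms by (intro O.integrable_const_bound[where B = 1]) (auto simp: tests_def obs_law_def)
qed

lemma bdd_above_type2:
  assumes "T \<in> tests n p"
  shows "bdd_above ((\<lambda>\<beta>. \<integral>\<omega>. 1 - T \<omega> \<partial>obs_law D n p \<beta>) ` S)"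
  using integral_obs_law_range[OF one_minus_test[OF assms]] by (intro bdd_aboveI[where M = 1]) auto

text \<open>Provides the lower bound that the real-valued infimum in \<open>minimax_risk\<close>
  requires. A nonempty \<open>Xi p s A\<close> is essential, since a real supremum over an empty
  family carries no information.\<close>

lemma risk_test_nonneg:
  assumes "T \<in> tests n p" "Xi p s A \<noteq> {}"
  shows "0 \<le> risk_test D n p s A T"
proof -
  obtain \<beta> where \<beta>: "\<beta> \<in> Xi p s A" using assms by auto
  have "0 \<le> (\<integral>\<omega>. 1 - T \<omega> \<partial>obs_law D n p \<beta>)"
    by (rule integral_obs_law_range[OF one_minus_test[OF assms(1)]])
  also have "\<dots> \<le> (SUP \<beta>\<in>Xi p s A. \<integral>\<omega>. 1 - T \<omega> \<partial>obs_law D n p \<beta>)"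
    by (rule cSUP_upper[OF \<beta> bdd_above_type2[OF assms(1)]])
  finally show ?thesis
    using integral_obs_law_range[OF assms(1)] by (simp add: risk_test_def)
qed

lemma minimax_risk_le_risk_test:
  assumes "T \<in> tests n p" "Xi p s A \<noteq> {}"
  shows "minimax_risk D n p s A \<le> risk_test D n p s A T"
  unfolding minimax_risk_def using assms risk_test_nonneg
  by (intro cINF_lower bdd_belowI[where m = 0]) auto

end

section \<open>The projection statistic and its test\<close>

definition proj_norm2 :: "nat \<Rightarrow> nat \<Rightarrow> (nat \<Rightarrow> real) \<times> (nat \<times> nat \<Rightarrow> real) \<Rightarrow> real" where
  "proj_norm2 n p = (\<lambda>(y, X). \<Sum>j<p. (\<Sum>i<n. gram_schmidt n X j i * y i)\<^sup>2)"

lemma measurable_proj_norm2 [measurable]: "proj_norm2 n p \<in> borel_measurable (obs_space n p)"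
proof -
  have [measurable]: "(\<lambda>\<omega>. gram_schmidt n (snd \<omega>) j i) \<in> borel_measurable (obs_space n p)" if "j < p" "i < n" for i j
    unfolding obs_space_def
    by (rule measurable_compose[OF measurable_snd measurable_gram_schmidt[OF that]])
  have [measurable]: "(\<lambda>\<omega>. fst \<omega> i) \<in> borel_measurable (obs_space n p)" if "i < n" for i
    unfolding obs_space_def
    by (rule measurable_compose[OF measurable_fst measurable_vec_space_component[OF that]])
  show ?thesis unfolding proj_norm2_def split_beta' by measurable
qed

text \<open>Given X of full rank, the statistic is noncentral chi-square with p degrees of freedom
  and noncentrality |X \<beta>|^2; this is its Laplace transform.\<close>

lemma (in design) gauss_laplace_proj:
  assumes pos_def: "\<And>v. \<exists>j<p. v j \<noteq> 0 \<Longrightarrow> 0 < (\<Sum>i<n. (\<Sum>j<p. X (i, j) * v j)\<^sup>2)" and "0 \<le> \<theta>"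
  shows "(\<integral>e. exp (- \<theta> * proj_norm2 n p (obs_map n p \<beta> X e, X)) \<partial>gauss n)
     = (1 + 2 * \<theta>) powr (- real p / 2) * exp (- (\<theta> / (1 + 2 * \<theta>)) * (\<Sum>i<n. (\<Sum>j<p. X (i, j) * \<beta> j)\<^sup>2))"
proof -
  have "proj_norm2 n p (obs_map n p \<beta> X e, X)
      = (\<Sum>j<p. ((\<Sum>i<n. gram_schmidt n X j i * (\<Sum>k<p. X (i, k) * \<beta> k)) + (\<Sum>i<n. gram_schmidt n X j i * e i))\<^sup>2)" for e
    unfolding proj_norm2_def split
    by (intro sum.cong refl arg_cong[where f = "\<lambda>x. x\<^sup>2"]) (simp add: distrib_left sum.distrib[symmetric])
  then show ?thesis
    using gauss_laplace_orthonormal[OF gram_schmidt_orthonormal[OF pos_def] assms(2),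
        of p "\<lambda>j. \<Sum>i<n. gram_schmidt n X j i * (\<Sum>k<p. X (i, k) * \<beta> k)"]
    by (simp only: sum_square_gram_schmidt_coords[OF pos_def])
qed

text \<open>The left side is the m-th null moment of the statistic normalised to mean one. In its
  logarithm the terms of first order in \<theta> cancel, which leaves p times a multiple of (m
  \<theta>)^2, bounded for \<theta> = p^(-1/2).\<close>

lemma powr_moment_ratio_le:
  fixes \<theta> :: real and m :: nat
  assumes "0 \<le> \<theta>"
  shows "((1 + 2 * \<theta>) powr (real p / 2)) ^ m * (1 + 2 * (real m * \<theta>)) powr (- real p / 2) \<le> exp (2 * real p * (real m * \<theta>)\<^sup>2)"
proof -
  define x where "x = 2 * (real m * \<theta>)"
  have x: "0 \<le> x" using assms by (simp add: x_def)
  \<comment> \<open>The product equals 1 + x^3; taking logarithms gives ln (1 + x) \<ge> x - x^2 for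
    all x \<ge> 0.\<close>
  have "1 \<le> (1 + x) * (1 - x + x\<^sup>2)" using x by (simp add: algebra_simps power2_eq_square)
  also have "\<dots> \<le> (1 + x) * exp (- x + x\<^sup>2)"
    using x exp_ge_add_one_self[of "- x + x\<^sup>2"] by (intro mult_left_mono) linarith+
  finally have "- ln (1 + x) \<le> - x + x\<^sup>2"
    using x by (simp add: ln_mult_pos flip: ln_ge_iff) (smt (verit) exp_gt_zero exp_ln ln_exp ln_ge_zero ln_mult_pos)
  moreover have "ln (1 + 2 * \<theta>) \<le> 2 * \<theta>" using assms ln_add_one_self_le_self[of "2 * \<theta>"] by simp
  then have "real m * ln (1 + 2 * \<theta>) \<le> x" 
    using mult_left_mono[of "ln (1 + 2 * \<theta>)" "2 * \<theta>" "real m"] by (simp add: x_def algebra_simps)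
  ultimately have "real m * ln (1 + 2 * \<theta>) - ln (1 + x) \<le> x\<^sup>2" by simp
  then have "real p / 2 * (real m * ln (1 + 2 * \<theta>) - ln (1 + x)) \<le> real p / 2 * x\<^sup>2"
    by (intro mult_left_mono) auto
  moreover have "((1 + 2 * \<theta>) powr (real p / 2)) ^ m * (1 + x) powr (- real p / 2)
      = exp (real p / 2 * (real m * ln (1 + 2 * \<theta>) - ln (1 + x)))"
    using assms x by (simp add: powr_def exp_of_nat_mult[symmetric] exp_add[symmetric] algebra_simps)
  ultimately show ?thesis by (simp add: x_def power2_eq_square algebra_simps)
qed

text \<open>The inequality min 1 W >= W - W^m for W >= 0 makes clipping the exponential statistic W cost
  only its m-th moment under the null; under the alternative clipping works in favour of the test.\<close>

lemma (in design) minimax_risk_le: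
  assumes pos_def: "AE X in D. \<forall>v. (\<exists>j<p. v j \<noteq> 0) \<longrightarrow> 0 < (\<Sum>i<n. (\<Sum>j<p. X (i, j) * v j)\<^sup>2)"
    and ne: "Xi p s A \<noteq> {}" and \<theta>: "0 \<le> \<theta>" and w: "0 \<le> w" and m: "1 \<le> (m::nat)"
    and B: "\<And>\<beta>. \<beta> \<in> Xi p s A \<Longrightarrow> (\<integral>X. exp (- (\<theta> / (1 + 2 * \<theta>)) * (\<Sum>i<n. (\<Sum>j<p. X (i, j) * \<beta> j)\<^sup>2)) \<partial>D) \<le> B"
  shows "minimax_risk D n p s A \<le> 1 - w * (1 - B) + w ^ m * exp (2 * real p * (real m * \<theta>)\<^sup>2)"
proof -
  \<comment> \<open>With this normalisation W has null mean exactly w, given any X of full column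
    rank.\<close>
  define K where "K = (1 + 2 * \<theta>) powr (real p / 2)"
  define W where "W \<omega> = w * K * exp (- \<theta> * proj_norm2 n p \<omega>)" for \<omega>
  define T where "T \<omega> = 1 - min 1 (W \<omega>)" for \<omega>
  define E where "E = exp (2 * real p * (real m * \<theta>)\<^sup>2)"
  have K: "K * (1 + 2 * \<theta>) powr (- real p / 2) = 1" "K \<ge> 0"
    using \<theta> by (auto simp: K_def powr_add[symmetric])
  have W0: "0 \<le> W \<omega>" for \<omega> using w K by (simp add: W_def)
  have T: "T \<in> tests n p"
    unfolding tests_def T_def W_def using W0[unfolded W_def] by (auto simp: min_def)
  have proj0: "0 \<le> proj_norm2 n p \<omega>" for \<omega>
    by (simp add: proj_norm2_def split_beta' sum_nonneg)
  have [measurable]: "(\<lambda>e. proj_norm2 n p (obs_map n p \<beta> X e, X)) \<in> borel_measurable (vec_space n)" if X: "X \<in> space D" for X \<beta>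
  proof -
    have "(\<lambda>x. proj_norm2 n p (obs_map n p \<beta> (fst x) (snd x), fst x)) \<in> borel_measurable (D \<Otimes>\<^sub>M gauss n)"
      using measurable_compose[OF measurable_obs[of \<beta>] measurable_proj_norm2] by (simp add: case_prod_beta)
    from measurable_compose[OF measurable_Pair1'[OF X] this] show ?thesis by simp
  qed
  have int_exp: "integrable (gauss n) (\<lambda>e. exp (- t * proj_norm2 n p (obs_map n p \<beta> X e, X)))" if "X \<in> space D" "0 \<le> t" for X \<beta> t
    using that proj0 by (intro G.integrable_const_bound[where B = 1]) auto
  have EW: "(\<integral>e. W (obs_map n p \<beta> X e, X) \<partial>gauss n) = w * exp (- (\<theta> / (1 + 2 * \<theta>)) * (\<Sum>i<n. (\<Sum>j<p. X (i, j) * \<beta> j)\<^sup>2))"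
    if "\<forall>v. (\<exists>j<p. v j \<noteq> 0) \<longrightarrow> 0 < (\<Sum>i<n. (\<Sum>j<p. X (i, j) * v j)\<^sup>2)" for X \<beta>
  proof -
    have "(\<integral>e. W (obs_map n p \<beta> X e, X) \<partial>gauss n) = w * K * (\<integral>e. exp (- \<theta> * proj_norm2 n p (obs_map n p \<beta> X e, X)) \<partial>gauss n)"
      by (simp add: W_def)
    also have "\<dots> = w * (K * (1 + 2 * \<theta>) powr (- real p / 2)) * exp (- (\<theta> / (1 + 2 * \<theta>)) * (\<Sum>i<n. (\<Sum>j<p. X (i, j) * \<beta> j)\<^sup>2))"
      using that by (subst gauss_laplace_proj[OF _ \<theta>]) (auto simp: mult.assoc)
    finally show ?thesis unfolding K(1) by simp
  qed
  have EWm: "(\<integral>e. W (obs_map n p \<beta> X e, X) ^ m \<partial>gauss n) \<le> w ^ m * E"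
    if "\<forall>v. (\<exists>j<p. v j \<noteq> 0) \<longrightarrow> 0 < (\<Sum>i<n. (\<Sum>j<p. X (i, j) * v j)\<^sup>2)" for X \<beta>
  proof -
    have W_pow: "W \<omega> ^ m = w ^ m * K ^ m * exp (- (real m * \<theta>) * proj_norm2 n p \<omega>)" for \<omega>
      by (simp add: W_def power_mult_distrib exp_of_nat_mult[symmetric] mult.assoc)
    have m\<theta>: "0 \<le> real m * \<theta>" using \<theta> by simp
    have "(\<integral>e. W (obs_map n p \<beta> X e, X) ^ m \<partial>gauss n)
        = w ^ m * K ^ m * (\<integral>e. exp (- (real m * \<theta>) * proj_norm2 n p (obs_map n p \<beta> X e, X)) \<partial>gauss n)"
      by (simp add: W_pow)
    also have "\<dots> = w ^ m * (K ^ m * (1 + 2 * (real m * \<theta>)) powr (- real p / 2)) * exp (- (real m * \<theta> / (1 + 2 * (real m * \<theta>))) * (\<Sum>i<n. (\<Sum>j<p. X (i, j) * \<beta> j)\<^sup>2))"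
      using that by (subst gauss_laplace_proj[OF _ m\<theta>]) (auto simp: mult.assoc)
    \<comment> \<open>A signal can only decrease the moment, so its exponential factor is bounded by
      one.\<close>
    also have "\<dots> \<le> w ^ m * E * 1"
      using w \<theta> K powr_moment_ratio_le[OF \<theta>, of p m] unfolding E_def K_def[symmetric]
      by (intro mult_mono) (auto intro!: mult_nonneg_nonneg divide_nonneg_nonneg sum_nonneg)
    finally show ?thesis by simp
  qed
  have min_bounds: "W \<omega> - W \<omega> ^ m \<le> min 1 (W \<omega>)" for \<omega>
  proof (cases "W \<omega> \<le> 1")
    case True then show ?thesis using W0[of \<omega>] by simp
  next
    case False then show ?thesis using power_increasing[OF m, of "W \<omega>"] by simp
  qed
  have int_T: "integrable (gauss n) (\<lambda>e. T (obs_map n p \<beta> X e, X))" if "X \<in> space D" for X \<beta>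
    using that unfolding T_def W_def
    by (intro G.integrable_const_bound[where B = 1]) (use W0[unfolded W_def] in \<open>auto simp: min_def\<close>)
  have int_min: "integrable (gauss n) (\<lambda>e. min 1 (W (obs_map n p \<beta> X e, X)))" if "X \<in> space D" for X \<beta>
    using that unfolding W_def
    by (intro G.integrable_const_bound[where B = 1]) (use W0[unfolded W_def] in \<open>auto simp: min_def\<close>)
  have int_W: "integrable (gauss n) (\<lambda>e. W (obs_map n p \<beta> X e, X))" if "X \<in> space D" for X \<beta>
    unfolding W_def using int_exp[OF that \<theta>] by simp
  have int_Wm: "integrable (gauss n) (\<lambda>e. W (obs_map n p \<beta> X e, X) ^ m)" if X: "X \<in> space D" for X \<beta>
  proof -
    have "integrable (gauss n) (\<lambda>e. w ^ m * K ^ m * exp (- (real m * \<theta>) * proj_norm2 n p (obs_map n p \<beta> X e, X)))"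
      using int_exp[OF X, of "real m * \<theta>"] \<theta> by simp
    then show ?thesis by (simp add: W_def power_mult_distrib exp_of_nat_mult[symmetric] mult.assoc)
  qed
  have outer: "integrable D (\<lambda>X. \<integral>e. T' (obs_map n p \<beta> X e, X) \<partial>gauss n)" if "T' \<in> tests n p" for T' \<beta>
    using P.integrable_fst'[OF integrable_test[OF that]] by simp
  have type1: "(\<integral>\<omega>. T \<omega> \<partial>obs_law D n p (\<lambda>_. 0)) \<le> 1 - w + w ^ m * E"
  proof -
    have "AE X in D. (\<integral>e. T (obs_map n p (\<lambda>_. 0) X e, X) \<partial>gauss n) \<le> 1 - w + w ^ m * E"
      using pos_def AE_space
    proof eventually_elim
      case (elim X)
      let ?W = "\<lambda>e. W (obs_map n p (\<lambda>_. 0) X e, X)"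
      have "(\<integral>e. T (obs_map n p (\<lambda>_. 0) X e, X) \<partial>gauss n) \<le> (\<integral>e. 1 - ?W e + ?W e ^ m \<partial>gauss n)"
      proof (rule integral_mono)
        fix e
        show "T (obs_map n p (\<lambda>_. 0) X e, X) \<le> 1 - ?W e + ?W e ^ m"
          unfolding T_def using min_bounds[of "(obs_map n p (\<lambda>_. 0) X e, X)"] by linarith
        show "integrable (gauss n) (\<lambda>e. T (obs_map n p (\<lambda>_. 0) X e, X))" by (rule int_T[OF elim(2)])
        show "integrable (gauss n) (\<lambda>e. 1 - ?W e + ?W e ^ m)"
          by (intro Bochner_Integration.integrable_add Bochner_Integration.integrable_diff
              int_W int_Wm elim G.integrable_const)
      qed
      also have "\<dots> = 1 - (\<integral>e. ?W e \<partial>gauss n) + (\<integral>e. ?W e ^ m \<partial>gauss n)"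
        by (subst Bochner_Integration.integral_add Bochner_Integration.integral_diff;
            (intro Bochner_Integration.integrable_diff int_W int_Wm elim G.integrable_const)?)+
           (simp add: G.prob_space[simplified])
      also have "\<dots> \<le> 1 - w + w ^ m * E"
        using EW[OF elim(1), of "\<lambda>_. 0"] EWm[OF elim(1), of "\<lambda>_. 0"] by simp
      finally show ?case .
    qed
    then show ?thesis
      unfolding integral_obs_law[OF T] by (intro D.integral_le_const outer T) auto
  qed
  have type2: "(\<integral>\<omega>. 1 - T \<omega> \<partial>obs_law D n p \<beta>) \<le> w * B" if \<beta>: "\<beta> \<in> Xi p s A" for \<beta>
  proof -
    have T': "(\<lambda>\<omega>. 1 - T \<omega>) \<in> tests n p" by (rule one_minus_test[OF T])
    let ?f = "\<lambda>X. w * exp (- (\<theta> / (1 + 2 * \<theta>)) * (\<Sum>i<n. (\<Sum>j<p. X (i, j) * \<beta> j)\<^sup>2))"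
    have "(\<integral>\<omega>. 1 - T \<omega> \<partial>obs_law D n p \<beta>) = (\<integral>X. (\<integral>e. 1 - T (obs_map n p \<beta> X e, X) \<partial>gauss n) \<partial>D)"
      using integral_obs_law[OF T'] .
    also have "\<dots> \<le> (\<integral>X. ?f X \<partial>D)"
    proof (rule integral_mono_AE)
      show "integrable D (\<lambda>X. \<integral>e. 1 - T (obs_map n p \<beta> X e, X) \<partial>gauss n)" using outer[OF T'] .
      show "integrable D ?f"
      proof (rule D.integrable_const_bound[where B = w])
        have "exp (- (\<theta> / (1 + 2 * \<theta>)) * (\<Sum>i<n. (\<Sum>j<p. X (i, j) * \<beta> j)\<^sup>2)) \<le> 1" for X
          using \<theta> by (simp add: sum_nonneg)
        then show "AE X in D. norm (?f X) \<le> w" 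
          using w by (intro AE_I2) (simp add: abs_mult mult_left_le)
      qed measurable
      show "AE X in D. (\<integral>e. 1 - T (obs_map n p \<beta> X e, X) \<partial>gauss n) \<le> ?f X"
        using pos_def AE_space
      proof eventually_elim
        case (elim X)
        have "(\<integral>e. 1 - T (obs_map n p \<beta> X e, X) \<partial>gauss n) \<le> (\<integral>e. W (obs_map n p \<beta> X e, X) \<partial>gauss n)"
          using int_min[OF elim(2)] int_W[OF elim(2)] by (intro integral_mono) (auto simp: T_def)
        also have "\<dots> = ?f X" by (rule EW[OF elim(1)])
        finally show ?case .
      qed
    qed
    also have "\<dots> = w * (\<integral>X. exp (- (\<theta> / (1 + 2 * \<theta>)) * (\<Sum>i<n. (\<Sum>j<p. X (i, j) * \<beta> j)\<^sup>2)) \<partial>D)" by simp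
    also have "\<dots> \<le> w * B" using B[OF \<beta>] w by (rule mult_left_mono)
    finally show ?thesis .
  qed
  have "minimax_risk D n p s A \<le> risk_test D n p s A T"
    by (rule minimax_risk_le_risk_test[OF T ne])
  also have "\<dots> \<le> (1 - w + w ^ m * E) + w * B"
    unfolding risk_test_def by (intro add_mono type1 cSUP_least ne type2)
  finally show ?thesis by (simp add: E_def algebra_simps)
qed

section \<open>A lower bound on the minimax risk\<close>

text \<open>The likelihood ratio of N(\<mu>, I) with respect to N(0, I).\<close>

definition shift_density :: "nat \<Rightarrow> (nat \<Rightarrow> real) \<Rightarrow> (nat \<Rightarrow> real) \<Rightarrow> real" where
  "shift_density n \<mu> e = exp ((\<Sum>i<n. \<mu> i * e i) - (\<Sum>i<n. (\<mu> i)\<^sup>2) / 2)"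

lemma shift_density_pos: "0 < shift_density n \<mu> e"
  by (simp add: shift_density_def)

lemma measurable_shift_density [measurable]: "shift_density n \<mu> \<in> borel_measurable (vec_space n)"
  unfolding shift_density_def by measurable

lemma nn_integral_shift_density: "(\<integral>\<^sup>+e. ennreal (shift_density n \<mu> e) \<partial>gauss n) = 1"
proof -
  interpret G: prob_space "gauss n" by (rule prob_space_gauss)
  have [measurable]: "(\<lambda>e. \<lambda>i\<in>{..<n}. \<mu> i + e i) \<in> measurable (gauss n) (vec_space n)"
    using measurable_shift_vec_space by (simp cong: measurable_cong_sets)
  have "prob_space (density (gauss n) (\<lambda>e. ennreal (shift_density n \<mu> e)))"
    using G.prob_space_distr[of "\<lambda>e. \<lambda>i\<in>{..<n}. \<mu> i + e i" "vec_space n"]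
    by (simp add: distr_gauss_shift[symmetric] shift_density_def)
  then have "emeasure (density (gauss n) (\<lambda>e. ennreal (shift_density n \<mu> e))) (space (gauss n)) = 1"
    using prob_space.emeasure_space_1 by fastforce
  moreover have "(\<integral>\<^sup>+e. ennreal (shift_density n \<mu> e) \<partial>gauss n)
      = emeasure (density (gauss n) (\<lambda>e. ennreal (shift_density n \<mu> e))) (space (gauss n))"
    by (subst emeasure_density) (auto intro!: nn_integral_cong)
  ultimately show ?thesis by simp
qed

text \<open>The second factor on the right has mass one under \<open>gauss n\<close>, so the mixed
  second moment of two likelihood ratios is the exponential of the inner product of the
  shifts.\<close>

lemma shift_density_mult:
  "shift_density n \<mu> e * shift_density n \<nu> e = exp (\<Sum>i<n. \<mu> i * \<nu> i) * shift_density n (\<lambda>i. \<mu> i + \<nu> i) e"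
  by (simp add: shift_density_def exp_add[symmetric] distrib_right sum.distrib power2_sum
      sum_distrib_left[symmetric] mult.assoc add_divide_distrib diff_divide_distrib)

context design
begin

abbreviation signal :: "(nat \<Rightarrow> real) \<Rightarrow> (nat \<times> nat \<Rightarrow> real) \<Rightarrow> nat \<Rightarrow> real" where
  "signal \<beta> X \<equiv> (\<lambda>i. \<Sum>j<p. X (i, j) * \<beta> j)"

text \<open>The design has the same law under every parameter, so the likelihood ratio against the
  null is that of the response given X.\<close>

abbreviation lik :: "(nat \<Rightarrow> real) \<Rightarrow> (nat \<times> nat \<Rightarrow> real) \<times> (nat \<Rightarrow> real) \<Rightarrow> real" where
  "lik \<beta> x \<equiv> shift_density n (signal \<beta> (fst x)) (snd x)"

lemma measurable_lik [measurable]: "lik \<beta> \<in> borel_measurable (D \<Otimes>\<^sub>M gauss n)"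
  unfolding shift_density_def by measurable

lemma nn_integral_lik: "(\<integral>\<^sup>+x. ennreal (lik \<beta> x) \<partial>(D \<Otimes>\<^sub>M gauss n)) = 1"
proof -
  have "(\<integral>\<^sup>+x. ennreal (lik \<beta> x) \<partial>(D \<Otimes>\<^sub>M gauss n)) = (\<integral>\<^sup>+X. \<integral>\<^sup>+e. ennreal (lik \<beta> (X, e)) \<partial>gauss n \<partial>D)"
    by (rule G.nn_integral_fst[symmetric]) measurable
  then show ?thesis by (simp add: nn_integral_shift_density D.emeasure_space_1[simplified])
qed

lemma nn_integral_lik_mult:
  "(\<integral>\<^sup>+x. ennreal (lik \<beta> x * lik \<gamma> x) \<partial>(D \<Otimes>\<^sub>M gauss n))
     = (\<integral>\<^sup>+X. ennreal (exp (\<Sum>i<n. signal \<beta> X i * signal \<gamma> X i)) \<partial>D)"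
proof -
  have "(\<integral>\<^sup>+x. ennreal (lik \<beta> x * lik \<gamma> x) \<partial>(D \<Otimes>\<^sub>M gauss n))
      = (\<integral>\<^sup>+X. \<integral>\<^sup>+e. ennreal (lik \<beta> (X, e) * lik \<gamma> (X, e)) \<partial>gauss n \<partial>D)"
    by (rule G.nn_integral_fst[symmetric]) measurable
  then show ?thesis
    by (simp add: shift_density_mult ennreal_mult nn_integral_cmult nn_integral_shift_density less_imp_le[OF shift_density_pos])
qed

lemma integrable_lik: "integrable (D \<Otimes>\<^sub>M gauss n) (lik \<beta>)"
  and integral_lik: "(\<integral>x. lik \<beta> x \<partial>(D \<Otimes>\<^sub>M gauss n)) = 1"
proof -
  show "integrable (D \<Otimes>\<^sub>M gauss n) (lik \<beta>)"
    by (intro integrableI_nonneg) (auto simp: nn_integral_lik less_imp_le[OF shift_density_pos])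
  show "(\<integral>x. lik \<beta> x \<partial>(D \<Otimes>\<^sub>M gauss n)) = 1"
    by (subst integral_eq_nn_integral) (auto simp: nn_integral_lik less_imp_le[OF shift_density_pos])
qed

lemma integrable_test_lik:
  assumes T: "T \<in> tests n p"
  shows "integrable (D \<Otimes>\<^sub>M gauss n) (\<lambda>x. T (snd x, fst x) * lik \<beta> x)"
proof (rule Bochner_Integration.integrable_bound[OF integrable_lik])
  have "(\<lambda>x. (snd x, fst x)) \<in> measurable (D \<Otimes>\<^sub>M gauss n) (obs_space n p)"
    unfolding obs_space_def by measurable
  from measurable_compose[OF this, of T borel] T
  have [measurable]: "(\<lambda>x. T (snd x, fst x)) \<in> borel_measurable (D \<Otimes>\<^sub>M gauss n)"
    by (simp add: tests_def)
  show "(\<lambda>x. T (snd x, fst x) * lik \<beta> x) \<in> borel_measurable (D \<Otimes>\<^sub>M gauss n)" by measurable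
  show "AE x in D \<Otimes>\<^sub>M gauss n. norm (T (snd x, fst x) * lik \<beta> x) \<le> norm (lik \<beta> x)"
    using test_range[OF T] by (intro AE_I2) (auto simp: space_pair_measure abs_mult intro!: mult_left_le_one_le)
qed

text \<open>Under the null the response is the noise itself, so
  \<open>D \<Otimes>\<^sub>M gauss n\<close> serves as the null law with the pair swapped, and all
  alternatives become densities on one space.\<close>

lemma integral_obs_law_lik:
  assumes T: "T \<in> tests n p"
  shows "(\<integral>\<omega>. T \<omega> \<partial>obs_law D n p \<beta>) = (\<integral>x. T (snd x, fst x) * lik \<beta> x \<partial>(D \<Otimes>\<^sub>M gauss n))"
proof -
  have meas: "(\<lambda>e. T (e, X)) \<in> borel_measurable (vec_space n)" if "X \<in> space D" for X
  proof -
    have "(\<lambda>e. (e, X)) \<in> measurable (vec_space n) (obs_space n p)"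
      unfolding obs_space_def by (measurable, use that in simp)
    from measurable_compose[OF this, of T borel] T show ?thesis by (simp add: tests_def)
  qed
  have "(\<integral>\<omega>. T \<omega> \<partial>obs_law D n p \<beta>) = (\<integral>X. (\<integral>e. T (obs_map n p \<beta> X e, X) \<partial>gauss n) \<partial>D)"
    by (rule integral_obs_law[OF T])
  also have "\<dots> = (\<integral>X. (\<integral>e. T (e, X) * lik \<beta> (X, e) \<partial>gauss n) \<partial>D)"
  proof (rule Bochner_Integration.integral_cong[OF refl])
    fix X assume X: "X \<in> space D"
    have [measurable]: "(\<lambda>e. T (e, X)) \<in> borel_measurable (vec_space n)" by (rule meas[OF X])
    have 1: "(\<lambda>e. \<lambda>i\<in>{..<n}. signal \<beta> X i + e i) \<in> measurable (gauss n) (vec_space n)"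
      using measurable_shift_vec_space by (simp cong: measurable_cong_sets)
    have "(\<integral>e. T (obs_map n p \<beta> X e, X) \<partial>gauss n)
        = (\<integral>e. T (e, X) \<partial>distr (gauss n) (vec_space n) (\<lambda>e. \<lambda>i\<in>{..<n}. signal \<beta> X i + e i))"
      by (rule integral_distr[OF 1, symmetric]) measurable
    also have "\<dots> = (\<integral>e. T (e, X) \<partial>density (gauss n) (\<lambda>e. ennreal (lik \<beta> (X, e))))"
      unfolding distr_gauss_shift shift_density_def by simp
    also have "\<dots> = (\<integral>e. T (e, X) * lik \<beta> (X, e) \<partial>gauss n)"
      by (subst integral_density) (auto simp: less_imp_le[OF shift_density_pos] mult.commute)
    finally show "(\<integral>e. T (obs_map n p \<beta> X e, X) \<partial>gauss n) = (\<integral>e. T (e, X) * lik \<beta> (X, e) \<partial>gauss n)" .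
  qed
  also have "\<dots> = (\<integral>x. T (snd x, fst x) * lik \<beta> x \<partial>(D \<Otimes>\<^sub>M gauss n))"
    using P.integral_fst'[OF integrable_test_lik[OF T, of \<beta>]] by simp
  finally show ?thesis .
qed

text \<open>Second moment method: chi2 bounds by c^2 the variance, under the null, of the likelihood ratio
  averaged over the family b.\<close>

lemma one_minus_minimax_risk_le:
  fixes b :: "'i \<Rightarrow> nat \<Rightarrow> real"
  assumes I: "finite I" "I \<noteq> {}" and b: "\<And>f. f \<in> I \<Longrightarrow> b f \<in> Xi p s A"
    and K0: "\<And>f g. f \<in> I \<Longrightarrow> g \<in> I \<Longrightarrow> 0 \<le> K f g"
    and K: "\<And>f g. f \<in> I \<Longrightarrow> g \<in> I \<Longrightarrow>
       (\<integral>\<^sup>+X. ennreal (exp (\<Sum>i<n. signal (b f) X i * signal (b g) X i)) \<partial>D) \<le> ennreal (K f g)"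
    and c: "0 < c" and chi2: "(\<Sum>f\<in>I. \<Sum>g\<in>I. K f g) \<le> (1 + c\<^sup>2) * (real (card I))\<^sup>2"
  shows "1 - minimax_risk D n p s A \<le> c"
proof -
  define N where "N = real (card I)"
  have N: "0 < N" using I by (simp add: N_def card_gt_0_iff)
  let ?M = "D \<Otimes>\<^sub>M gauss n"
  \<comment> \<open>The averaged likelihood ratio minus one; its second moment is the chi-square
    divergence of the mixture from the null.\<close>
  define h where "h x = (\<Sum>f\<in>I. lik (b f) x - 1) / N" for x
  have int2: "integrable ?M (\<lambda>x. lik (b f) x * lik (b g) x)" if "f \<in> I" "g \<in> I" for f g
    using K[OF that] by (intro integrableI_nonneg)
      (auto simp: less_imp_le[OF mult_pos_pos[OF shift_density_pos shift_density_pos]] nn_integral_lik_mult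
         intro: le_less_trans[OF _ ennreal_less_top])
  have le2: "(\<integral>x. lik (b f) x * lik (b g) x \<partial>?M) \<le> K f g" if "f \<in> I" "g \<in> I" for f g
    using K[OF that] K0[OF that] by (intro integral_real_bounded) (auto simp: nn_integral_lik_mult)
  have prod_eq: "(lik (b f) x - 1) * (lik (b g) x - 1) = lik (b f) x * lik (b g) x - lik (b f) x - lik (b g) x + 1" for f g x
    by (simp add: algebra_simps)
  have int3: "integrable ?M (\<lambda>x. (lik (b f) x - 1) * (lik (b g) x - 1))" if "f \<in> I" "g \<in> I" for f g
    unfolding prod_eq using int2[OF that] integrable_lik
    by (intro Bochner_Integration.integrable_add Bochner_Integration.integrable_diff P.integrable_const) auto
  have le3: "(\<integral>x. (lik (b f) x - 1) * (lik (b g) x - 1) \<partial>?M) \<le> K f g - 1" if "f \<in> I" "g \<in> I" for f g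
  proof -
    have "(\<integral>x. (lik (b f) x - 1) * (lik (b g) x - 1) \<partial>?M)
        = (\<integral>x. lik (b f) x * lik (b g) x \<partial>?M) - (\<integral>x. lik (b f) x \<partial>?M) - (\<integral>x. lik (b g) x \<partial>?M) + (\<integral>x. 1 \<partial>?M)"
      unfolding prod_eq using int2[OF that] integrable_lik
      by (subst Bochner_Integration.integral_add Bochner_Integration.integral_diff;
          (intro Bochner_Integration.integrable_diff P.integrable_const)?; simp)+
    then show ?thesis using le2[OF that] P.prob_space by (simp add: integral_lik)
  qed
  have h2: "(h x)\<^sup>2 = (\<Sum>f\<in>I. \<Sum>g\<in>I. (lik (b f) x - 1) * (lik (b g) x - 1)) / N\<^sup>2" for x
    by (simp add: h_def power2_eq_square sum_product)
  have int_h: "integrable ?M h"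
    unfolding h_def using integrable_lik by (intro integrable_divide Bochner_Integration.integrable_sum Bochner_Integration.integrable_diff P.integrable_const) auto
  have int_h2: "integrable ?M (\<lambda>x. (h x)\<^sup>2)"
    unfolding h2 by (intro integrable_divide Bochner_Integration.integrable_sum int3)
  have "(\<integral>x. (h x)\<^sup>2 \<partial>?M) = (\<Sum>f\<in>I. \<Sum>g\<in>I. \<integral>x. (lik (b f) x - 1) * (lik (b g) x - 1) \<partial>?M) / N\<^sup>2"
    unfolding h2 by (simp add: int3)
  also have "\<dots> \<le> (\<Sum>f\<in>I. \<Sum>g\<in>I. K f g - 1) / N\<^sup>2"
    by (intro divide_right_mono sum_mono le3) auto
  also have "\<dots> = ((\<Sum>f\<in>I. \<Sum>g\<in>I. K f g) - N\<^sup>2) / N\<^sup>2"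
    by (simp add: sum_subtractf N_def power2_eq_square)
  also have "\<dots> \<le> c\<^sup>2"
    using chi2 N by (simp add: N_def[symmetric] pos_divide_le_eq algebra_simps)
  finally have Eh2: "(\<integral>x. (h x)\<^sup>2 \<partial>?M) \<le> c\<^sup>2" .
  have gain: "(\<Sum>f\<in>I. (\<integral>\<omega>. T \<omega> \<partial>obs_law D n p (b f)) - (\<integral>\<omega>. T \<omega> \<partial>obs_law D n p (\<lambda>_. 0))) \<le> N * c"
    if T: "T \<in> tests n p" for T
  proof -
    let ?T = "\<lambda>x. T (snd x, fst x)"
    have lik0: "lik (\<lambda>_. 0) x = 1" for x by (simp add: shift_density_def)
    have int_T: "integrable ?M ?T" using integrable_test_lik[OF T, of "\<lambda>_. 0"] by (simp add: shift_density_def)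
    have "(\<integral>\<omega>. T \<omega> \<partial>obs_law D n p (b f)) - (\<integral>\<omega>. T \<omega> \<partial>obs_law D n p (\<lambda>_. 0)) = (\<integral>x. ?T x * (lik (b f) x - 1) \<partial>?M)" for f
      using integrable_test_lik[OF T] int_T
      by (simp add: integral_obs_law_lik[OF T] shift_density_def[of _ "\<lambda>_. 0"] right_diff_distrib)
    moreover have int: "integrable ?M (\<lambda>x. ?T x * (lik (b f) x - 1))" for f
      using integrable_test_lik[OF T] int_T by (simp add: right_diff_distrib)
    ultimately have "(\<Sum>f\<in>I. (\<integral>\<omega>. T \<omega> \<partial>obs_law D n p (b f)) - (\<integral>\<omega>. T \<omega> \<partial>obs_law D n p (\<lambda>_. 0)))
        = (\<integral>x. (\<Sum>f\<in>I. ?T x * (lik (b f) x - 1)) \<partial>?M)"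
      by (simp add: integral_sum)
    also have "\<dots> \<le> (\<integral>x. N * (((h x)\<^sup>2 / c + c) / 2) \<partial>?M)"
    proof (rule integral_mono)
      show "integrable ?M (\<lambda>x. \<Sum>f\<in>I. ?T x * (lik (b f) x - 1))" by (intro Bochner_Integration.integrable_sum int)
      show "integrable ?M (\<lambda>x. N * (((h x)\<^sup>2 / c + c) / 2))"
        using int_h2 by (intro integrable_mult_right integrable_divide Bochner_Integration.integrable_add P.integrable_const) auto
      fix x assume x: "x \<in> space ?M"
      have "(\<Sum>f\<in>I. ?T x * (lik (b f) x - 1)) = N * (?T x * h x)"
        using N by (simp add: h_def sum_distrib_left[symmetric])
      also have "?T x * h x \<le> \<bar>h x\<bar>"
      proof -
        have "0 \<le> ?T x" "?T x \<le> 1" using test_range[OF T] x by (auto simp: space_pair_measure)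
        then have "\<bar>?T x * h x\<bar> \<le> \<bar>h x\<bar>" by (auto simp: abs_mult intro!: mult_left_le_one_le)
        then show ?thesis by linarith
      qed
      \<comment> \<open>The arithmetic-geometric mean inequality with weight c replaces
        Cauchy-Schwarz: together with E h^2 \<le> c^2 it gives E |h| \<le> c after
        integration.\<close>
      also have "\<bar>h x\<bar> \<le> ((h x)\<^sup>2 / c + c) / 2"
      proof -
        have "0 \<le> (\<bar>h x\<bar> - c)\<^sup>2" by simp
        then have "2 * \<bar>h x\<bar> * c \<le> (h x)\<^sup>2 + c\<^sup>2" by (simp add: power2_diff)
        then show ?thesis using c by (simp add: field_simps power2_eq_square)
      qed
      finally show "(\<Sum>f\<in>I. ?T x * (lik (b f) x - 1)) \<le> N * (((h x)\<^sup>2 / c + c) / 2)"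
        using N by simp
    qed
    also have "\<dots> = N * (((\<integral>x. (h x)\<^sup>2 \<partial>?M) / c + c) / 2)"
      using int_h2 P.prob_space by simp
    also have "\<dots> \<le> N * ((c\<^sup>2 / c + c) / 2)"
      using Eh2 N c by (intro mult_left_mono divide_right_mono add_right_mono) auto
    finally show ?thesis using c by (simp add: power2_eq_square)
  qed
  have "1 - c \<le> risk_test D n p s A T" if T: "T \<in> tests n p" for T
  proof -
    let ?S = "SUP \<beta>\<in>Xi p s A. \<integral>\<omega>. 1 - T \<omega> \<partial>obs_law D n p \<beta>"
    let ?E0 = "\<integral>\<omega>. T \<omega> \<partial>obs_law D n p (\<lambda>_. 0)"
    \<comment> \<open>The worst case over \<open>Xi p s A\<close> dominates every member of the
      family, hence also their average.\<close>
    have "1 - (\<integral>\<omega>. T \<omega> \<partial>obs_law D n p (b f)) \<le> ?S" if f: "f \<in> I" for f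
    proof -
      interpret O: prob_space "obs_law D n p (b f)" by (rule prob_space_obs_law)
      have "1 - (\<integral>\<omega>. T \<omega> \<partial>obs_law D n p (b f)) = (\<integral>\<omega>. 1 - T \<omega> \<partial>obs_law D n p (b f))"
        using integrable_obs_law[OF T] O.prob_space by simp
      then show ?thesis using cSUP_upper[OF b[OF f] bdd_above_type2[OF T]] by simp
    qed
    then have "(\<Sum>f\<in>I. 1 - (\<integral>\<omega>. T \<omega> \<partial>obs_law D n p (b f))) \<le> N * ?S"
      unfolding N_def by (rule sum_bounded_above)
    then have "N - (\<Sum>f\<in>I. (\<integral>\<omega>. T \<omega> \<partial>obs_law D n p (b f))) \<le> N * ?S"
      by (simp add: sum_subtractf N_def)
    moreover have "(\<Sum>f\<in>I. (\<integral>\<omega>. T \<omega> \<partial>obs_law D n p (b f))) - N * ?E0 \<le> N * c"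
      using gain[OF T] by (simp add: sum_subtractf N_def)
    ultimately have "N * (1 - c) \<le> N * (?E0 + ?S)" by (simp add: algebra_simps)
    then show ?thesis using N by (simp add: risk_test_def)
  qed
  moreover have "tests n p \<noteq> {}"
    by (auto simp: tests_def intro!: exI[of _ "\<lambda>_. 0"])
  ultimately have "1 - c \<le> minimax_risk D n p s A"
    unfolding minimax_risk_def by (intro cINF_greatest) auto
  then show ?thesis by simp
qed

end

section \<open>Sub-Gaussian rows\<close>

text \<open>Here v stands for the larger of 1 and the sub-Gaussian parameter. The enlargement only
  weakens the moment bound, and it gives v \<le> v^2 when constants are collected.\<close>

locale subgaussian_row =
  fixes \<mu> :: "(nat \<Rightarrow> real) measure" and p :: nat and v :: real
  assumes prob_row: "prob_space \<mu>"
    and sets_row [measurable_cong, simp]: "sets \<mu> = sets (vec_space p)"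
    and second_moment: "\<And>j k. j < p \<Longrightarrow> k < p \<Longrightarrow> integrable \<mu> (\<lambda>x. x j * x k)"
      "\<And>j k. j < p \<Longrightarrow> k < p \<Longrightarrow> (\<integral>x. x j * x k \<partial>\<mu>) = (if j = k then 1 else 0)"
    and mgf: "\<And>u t. (\<Sum>j<p. (u j)\<^sup>2) = 1 \<Longrightarrow>
       integrable \<mu> (\<lambda>x. exp (t * (\<Sum>j<p. u j * x j))) \<and>
       ln (\<integral>x. exp (t * (\<Sum>j<p. u j * x j)) \<partial>\<mu>) \<le> v * t\<^sup>2 / 2"
    and v_ge_1: "1 \<le> v"
begin

sublocale prob_space \<mu> by (rule prob_row)

definition lin :: "(nat \<Rightarrow> real) \<Rightarrow> (nat \<Rightarrow> real) \<Rightarrow> real" where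
  "lin b x = (\<Sum>j<p. x j * b j)"

lemma measurable_lin [measurable]: "lin b \<in> borel_measurable (vec_space p)"
  unfolding lin_def by measurable

lemma integrable_lin_mult: "integrable \<mu> (\<lambda>x. lin b x * lin c x)"
  and integral_lin_mult: "(\<integral>x. lin b x * lin c x \<partial>\<mu>) = (\<Sum>j<p. b j * c j)"
proof -
  have eq: "lin b x * lin c x = (\<Sum>j<p. \<Sum>k<p. b j * c k * (x j * x k))" for x
    by (simp add: lin_def sum_product mult_ac)
  show "integrable \<mu> (\<lambda>x. lin b x * lin c x)"
    unfolding eq by (auto intro!: Bochner_Integration.integrable_sum simp: second_moment)
  have "(\<integral>x. lin b x * lin c x \<partial>\<mu>) = (\<Sum>j<p. \<integral>x. (\<Sum>k<p. b j * c k * (x j * x k)) \<partial>\<mu>)"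
    unfolding eq by (rule Bochner_Integration.integral_sum)
      (auto intro!: Bochner_Integration.integrable_sum simp: second_moment)
  also have "\<dots> = (\<Sum>j<p. \<Sum>k<p. \<integral>x. b j * c k * (x j * x k) \<partial>\<mu>)"
    by (intro sum.cong refl Bochner_Integration.integral_sum) (auto simp: second_moment)
  also have "\<dots> = (\<Sum>j<p. \<Sum>k<p. b j * c k * (\<integral>x. x j * x k \<partial>\<mu>))" by simp
  also have "\<dots> = (\<Sum>j<p. \<Sum>k<p. if j = k then b j * c k else 0)"
    by (intro sum.cong refl) (simp add: second_moment(2))
  finally show "(\<integral>x. lin b x * lin c x \<partial>\<mu>) = (\<Sum>j<p. b j * c j)" by simp
qed

lemma nn_integral_exp_lin_le:
  "(\<integral>\<^sup>+x. ennreal (exp (t * lin b x)) \<partial>\<mu>) \<le> ennreal (exp (v * t\<^sup>2 * (\<Sum>j<p. (b j)\<^sup>2) / 2))"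
proof (cases "(\<Sum>j<p. (b j)\<^sup>2) = 0")
  case True
  then have "lin b x = 0" for x by (simp add: lin_def sum_nonneg_eq_0_iff)
  with True show ?thesis by (simp add: emeasure_space_1[simplified])
next
  case False
  define r where "r = sqrt (\<Sum>j<p. (b j)\<^sup>2)"
  have r: "0 < r" "r\<^sup>2 = (\<Sum>j<p. (b j)\<^sup>2)"
    using False sum_nonneg[of "{..<p}" "\<lambda>j. (b j)\<^sup>2"] by (auto simp: r_def less_le)
  define u where "u j = b j / r" for j
  have "(\<Sum>j<p. (u j)\<^sup>2) = 1"
    using r False by (simp add: u_def power_divide sum_divide_distrib[symmetric])
  from mgf[OF this, of "t * r"] have m: "integrable \<mu> (\<lambda>x. exp (t * r * (\<Sum>j<p. u j * x j)))"
    "ln (\<integral>x. exp (t * r * (\<Sum>j<p. u j * x j)) \<partial>\<mu>) \<le> v * (t * r)\<^sup>2 / 2" by auto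
  have eq: "t * r * (\<Sum>j<p. u j * x j) = t * lin b x" for x
    using r by (simp add: lin_def u_def sum_distrib_left mult_ac)
  have int: "integrable \<mu> (\<lambda>x. exp (t * lin b x))" using m(1) unfolding eq .
  have le: "ln (\<integral>x. exp (t * lin b x) \<partial>\<mu>) \<le> v * (t * r)\<^sup>2 / 2" using m(2) unfolding eq .
  \<comment> \<open>The bound on the logarithm can be exponentiated when the integral is positive;
    if it is 0, the claim is trivial.\<close>
  have "0 \<le> (\<integral>x. exp (t * lin b x) \<partial>\<mu>)" by (intro integral_nonneg_AE) auto
  then have "(\<integral>x. exp (t * lin b x) \<partial>\<mu>) \<le> exp (v * (t * r)\<^sup>2 / 2)"
    using le by (metis exp_ge_zero exp_le_cancel_iff exp_ln less_le)
  then show ?thesis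
    using int by (subst nn_integral_eq_integral) (auto simp: power_mult_distrib r(2) mult.assoc)
qed

text \<open>The square is linearised by a Gaussian average: exp (c z^2) = E exp (sqrt (2 c) g z).\<close>

lemma nn_integral_exp_lin_square_le:
  assumes "0 \<le> c" "4 * v * c * (\<Sum>j<p. (b j)\<^sup>2) \<le> 1"
  shows "(\<integral>\<^sup>+x. ennreal (exp (c * (lin b x)\<^sup>2)) \<partial>\<mu>) \<le> 2"
proof -
  interpret N: prob_space std_normal by (rule prob_space_std_normal)
  interpret Q: pair_prob_space \<mu> std_normal ..
  define s where "s = sqrt (2 * c)"
  have s: "s\<^sup>2 = 2 * c" using assms by (simp add: s_def)
  have "(\<integral>\<^sup>+x. ennreal (exp (c * (lin b x)\<^sup>2)) \<partial>\<mu>)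
      = (\<integral>\<^sup>+x. (\<integral>\<^sup>+g. ennreal (exp ((s * lin b x) * g)) \<partial>std_normal) \<partial>\<mu>)"
    by (simp add: nn_integral_std_normal_exp power_mult_distrib s)
  also have "\<dots> = (\<integral>\<^sup>+g. (\<integral>\<^sup>+x. ennreal (exp ((s * lin b x) * g)) \<partial>\<mu>) \<partial>std_normal)"
    by (rule Q.Fubini'[symmetric]) measurable
  also have "\<dots> \<le> (\<integral>\<^sup>+g. ennreal (exp (g\<^sup>2 / 4)) \<partial>std_normal)"
  proof (rule nn_integral_mono)
    fix g
    have "(\<integral>\<^sup>+x. ennreal (exp ((s * lin b x) * g)) \<partial>\<mu>) = (\<integral>\<^sup>+x. ennreal (exp ((s * g) * lin b x)) \<partial>\<mu>)"
      by (simp add: mult_ac)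
    also have "\<dots> \<le> ennreal (exp (v * (s * g)\<^sup>2 * (\<Sum>j<p. (b j)\<^sup>2) / 2))"
      by (rule nn_integral_exp_lin_le)
    \<comment> \<open>The smallness condition says exactly that the first factor is at most one, so
      the average over g is bounded by the expectation of exp (g^2 / 4).\<close>
    also have "v * (s * g)\<^sup>2 * (\<Sum>j<p. (b j)\<^sup>2) / 2 = (4 * v * c * (\<Sum>j<p. (b j)\<^sup>2)) * (g\<^sup>2 / 4)"
      by (simp add: power_mult_distrib s)
    also have "ennreal (exp \<dots>) \<le> ennreal (exp (g\<^sup>2 / 4))"
      using mult_right_mono[OF assms(2), of "g\<^sup>2 / 4"] by (intro ennreal_leI) simp
    finally show "(\<integral>\<^sup>+x. ennreal (exp ((s * lin b x) * g)) \<partial>\<mu>) \<le> ennreal (exp (g\<^sup>2 / 4))" .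
  qed
  also have "\<dots> = ennreal (sqrt 2)" by (rule nn_integral_std_normal_exp_square_quarter)
  also have "\<dots> \<le> ennreal 2" by (intro ennreal_leI real_le_lsqrt) auto
  finally show ?thesis by simp
qed

lemma integrable_exp_lin_square:
  assumes "0 \<le> c" "4 * v * c * (\<Sum>j<p. (b j)\<^sup>2) \<le> 1"
  shows "integrable \<mu> (\<lambda>x. exp (c * (lin b x)\<^sup>2))"
  using nn_integral_exp_lin_square_le[OF assms]
  by (intro integrableI_nonneg) (auto intro: le_less_trans simp: ennreal_numeral_less_top)

lemma integral_exp_lin_square_le:
  assumes "0 \<le> c" "4 * v * c * (\<Sum>j<p. (b j)\<^sup>2) \<le> 1"
  shows "(\<integral>x. exp (c * (lin b x)\<^sup>2) \<partial>\<mu>) \<le> 2"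
  using nn_integral_exp_lin_square_le[OF assms] by (intro integral_real_bounded) auto

end

section \<open>Taylor bounds for the exponential\<close>

lemma square_le_exp: "0 \<le> (x::real) \<Longrightarrow> x\<^sup>2 / 2 \<le> exp x"
  using exp_lower_Taylor_quadratic[of x] by simp

text \<open>The linear term is kept exactly: its expectation will be the inner product of the two
  parameters, and everything else counts as error.\<close>

lemma exp_le_quadratic_remainder: "exp (u::real) \<le> 1 + u + u\<^sup>2 / 2 * exp \<bar>u\<bar>"
proof -
  obtain t where t: "\<bar>t\<bar> \<le> \<bar>u\<bar>" "exp u = (\<Sum>m<2. u ^ m / fact m) + exp t / fact 2 * u ^ 2"
    using Maclaurin_exp_le[of u 2] by blast
  have "exp t * u\<^sup>2 \<le> exp \<bar>u\<bar> * u\<^sup>2" using t(1) by (intro mult_right_mono) auto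
  then show ?thesis using t(2) by (simp add: numeral_2_eq_2 algebra_simps)
qed

text \<open>The Lagrange remainder of third order is nonpositive for nonnegative u.\<close>

lemma exp_minus_le_quadratic: "0 \<le> (u::real) \<Longrightarrow> exp (- u) \<le> 1 - u + u\<^sup>2 / 2"
proof -
  assume u: "0 \<le> u"
  obtain t where t: "\<bar>t\<bar> \<le> \<bar>- u\<bar>" "exp (- u) = (\<Sum>m<3. (- u) ^ m / fact m) + exp t / fact 3 * (- u) ^ 3"
    using Maclaurin_exp_le[of "- u" 3] by blast
  have "exp t / fact 3 * (- u) ^ 3 \<le> 0"
    using u by (intro mult_nonneg_nonpos) (auto simp: power3_eq_cube)
  moreover have "(\<Sum>m<3. (- u) ^ m / fact m) = 1 - u + u\<^sup>2 / 2"
    by (simp add: numeral_3_eq_3 power2_eq_square)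
  ultimately show ?thesis using t(2) by linarith
qed

context subgaussian_row
begin

text \<open>By isotropy the linear term averages to the inner product of b and c; the remainder is
  dominated by exponentials of squares. The excess v^2 \<rho>^2 is quadratic in the signal energy,
  so it stays small even after summation over n rows.\<close>

lemma nn_integral_exp_lin_mult_le:
  assumes \<rho>: "0 < \<rho>" "8 * v * \<rho> \<le> 1" and b: "(\<Sum>j<p. (b j)\<^sup>2) \<le> \<rho>" and c: "(\<Sum>j<p. (c j)\<^sup>2) \<le> \<rho>"
  shows "(\<integral>\<^sup>+x. ennreal (exp (lin b x * lin c x)) \<partial>\<mu>) \<le> ennreal (exp ((\<Sum>j<p. b j * c j) + 128 * v\<^sup>2 * \<rho>\<^sup>2))"
proof -
  \<comment> \<open>The largest k for which exp (k z^2) is guaranteed to have mean at most 2 when z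
    is a linear form of energy \<rho>; the smallness of \<rho> gives k \<ge> 2.\<close>
  define k where "k = 1 / (4 * v * \<rho>)"
  have v: "0 < v" using v_ge_1 by simp
  have k: "2 \<le> k" using \<rho> v by (simp add: k_def field_simps)
  have kb: "4 * v * k * (\<Sum>j<p. (a j)\<^sup>2) \<le> 1" if "(\<Sum>j<p. (a j)\<^sup>2) \<le> \<rho>" for a :: "nat \<Rightarrow> real"
    using that \<rho> v by (simp add: k_def)
  let ?G = "\<lambda>x. 1 + lin b x * lin c x + 32 * v\<^sup>2 * \<rho>\<^sup>2 * (exp (k * (lin b x)\<^sup>2) + exp (k * (lin c x)\<^sup>2))"
  have G: "exp (lin b x * lin c x) \<le> ?G x" for x
  proof -
    define U where "U = lin b x * lin c x"
    define V where "V = ((lin b x)\<^sup>2 + (lin c x)\<^sup>2) / 2"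
    have "0 \<le> (\<bar>lin b x\<bar> - \<bar>lin c x\<bar>)\<^sup>2" by simp
    then have UV: "\<bar>U\<bar> \<le> V" by (simp add: U_def V_def abs_mult power2_diff)
    have V0: "0 \<le> V" by (simp add: V_def)
    have "U\<^sup>2 / 2 * exp \<bar>U\<bar> \<le> V\<^sup>2 / 2 * exp V"
      using UV V0 power_mono[OF UV, of 2] by (intro mult_mono) auto
    \<comment> \<open>The available exponent k V is split in halves: one absorbs V^2 / 2 at the
      price 4 / k^2, the other absorbs exp V because k \<ge> 2.\<close>
    also have "\<dots> \<le> (4 / k\<^sup>2) * exp (k / 2 * V) * exp (k / 2 * V)"
    proof (rule mult_mono)
    show "V\<^sup>2 / 2 \<le> (4 / k\<^sup>2) * exp (k / 2 * V)"
    proof -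
      have "(k / 2 * V)\<^sup>2 / 2 \<le> exp (k / 2 * V)" using k V0 by (intro square_le_exp) auto
      then have "(4 / k\<^sup>2) * ((k / 2 * V)\<^sup>2 / 2) \<le> (4 / k\<^sup>2) * exp (k / 2 * V)" by (intro mult_left_mono) auto
      then show ?thesis using k by (simp add: power_mult_distrib power_divide)
    qed
    show "exp V \<le> exp (k / 2 * V)" using k V0 mult_right_mono[of 2 k V] by simp
    qed auto
    finally have 1: "U\<^sup>2 / 2 * exp \<bar>U\<bar> \<le> (4 / k\<^sup>2) * (exp (k / 2 * V) * exp (k / 2 * V))"
      by (simp only: mult.assoc)
    have "exp (k / 2 * V) * exp (k / 2 * V) = exp (k / 2 * (lin b x)\<^sup>2) * exp (k / 2 * (lin c x)\<^sup>2)"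
      by (simp add: exp_add[symmetric] V_def field_simps)
    also have "\<dots> \<le> (exp (k * (lin b x)\<^sup>2) + exp (k * (lin c x)\<^sup>2)) / 2"
    proof -
      have "0 \<le> (exp (k / 2 * (lin b x)\<^sup>2) - exp (k / 2 * (lin c x)\<^sup>2))\<^sup>2" by simp
      then show ?thesis by (simp add: power2_diff exp_double[symmetric])
    qed
    finally have 2: "(4 / k\<^sup>2) * (exp (k / 2 * V) * exp (k / 2 * V))
        \<le> (4 / k\<^sup>2) * ((exp (k * (lin b x)\<^sup>2) + exp (k * (lin c x)\<^sup>2)) / 2)"
      by (rule mult_left_mono) simp
    have 3: "4 / k\<^sup>2 = 64 * v\<^sup>2 * \<rho>\<^sup>2" by (simp add: k_def power_divide power_mult_distrib)
    have "U\<^sup>2 / 2 * exp \<bar>U\<bar> \<le> 32 * v\<^sup>2 * \<rho>\<^sup>2 * (exp (k * (lin b x)\<^sup>2) + exp (k * (lin c x)\<^sup>2))"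
      using order_trans[OF 1 2] unfolding 3 by (simp add: algebra_simps)
    then show ?thesis using exp_le_quadratic_remainder[of U] by (simp add: U_def)
  qed
  have int: "integrable \<mu> (\<lambda>x. exp (k * (lin b x)\<^sup>2))" "integrable \<mu> (\<lambda>x. exp (k * (lin c x)\<^sup>2))"
    using k b c by (intro integrable_exp_lin_square kb; simp)+
  have int_G: "integrable \<mu> ?G" using int integrable_lin_mult by simp
  have "(\<integral>\<^sup>+x. ennreal (exp (lin b x * lin c x)) \<partial>\<mu>) \<le> (\<integral>\<^sup>+x. ennreal (?G x) \<partial>\<mu>)"
    using G by (intro nn_integral_mono ennreal_leI) auto
  also have "\<dots> = ennreal (\<integral>x. ?G x \<partial>\<mu>)"
    using G by (intro nn_integral_eq_integral int_G AE_I2) (auto intro: order_trans[OF exp_ge_zero])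
  also have "(\<integral>x. ?G x \<partial>\<mu>) = 1 + (\<Sum>j<p. b j * c j)
      + 32 * v\<^sup>2 * \<rho>\<^sup>2 * ((\<integral>x. exp (k * (lin b x)\<^sup>2) \<partial>\<mu>) + (\<integral>x. exp (k * (lin c x)\<^sup>2) \<partial>\<mu>))"
    using int integrable_lin_mult by (simp add: integral_lin_mult prob_space[simplified])
  also have "ennreal \<dots> \<le> ennreal (1 + (\<Sum>j<p. b j * c j) + 32 * v\<^sup>2 * \<rho>\<^sup>2 * (2 + 2))"
    using k b c by (intro ennreal_leI add_left_mono mult_left_mono add_mono integral_exp_lin_square_le kb) auto
  also have "\<dots> \<le> ennreal (exp ((\<Sum>j<p. b j * c j) + 128 * v\<^sup>2 * \<rho>\<^sup>2))"
    using exp_ge_add_one_self[of "(\<Sum>j<p. b j * c j) + 128 * v\<^sup>2 * \<rho>\<^sup>2"] by (intro ennreal_leI) (simp add: algebra_simps)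
  finally show ?thesis .
qed

text \<open>The energy t |b|^2 may be arbitrarily large, whereas a Taylor expansion needs it small.
  The number x is a truncated energy, and decreasing t until t |b|^2 equals x only increases the
  integral.\<close>

lemma nn_integral_exp_minus_lin_square_le:
  assumes t: "0 \<le> t" and x: "0 \<le> x" "x \<le> t * (\<Sum>j<p. (b j)\<^sup>2)" "64 * v\<^sup>2 * x \<le> 1"
  shows "(\<integral>\<^sup>+y. ennreal (exp (- t * (lin b y)\<^sup>2)) \<partial>\<mu>) \<le> ennreal (exp (- x / 2))"
proof (cases "x = 0")
  case True
  have "(\<integral>\<^sup>+y. ennreal (exp (- t * (lin b y)\<^sup>2)) \<partial>\<mu>) \<le> (\<integral>\<^sup>+y. 1 \<partial>\<mu>)"
    using t by (intro nn_integral_mono) auto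
  then show ?thesis using True by (simp add: emeasure_space_1[simplified])
next
  case False
  then have x0: "0 < x" using x by simp
  have v: "0 < v" using v_ge_1 by simp
  define \<rho> where "\<rho> = (\<Sum>j<p. (b j)\<^sup>2)"
  have \<rho>: "0 < \<rho>" using x0 x(2) t unfolding \<rho>_def[symmetric]
    by (metis less_le_trans mult_nonneg_nonpos not_le)
  \<comment> \<open>The reduced coefficient, chosen so that u |b|^2 = x.\<close>
  define u where "u = x / \<rho>"
  have u: "0 < u" "u \<le> t" "u * \<rho> = x" using x0 \<rho> x(2) by (auto simp: u_def \<rho>_def[symmetric] pos_divide_le_eq)
  define k where "k = 1 / (4 * v * \<rho>)"
  have k: "0 < k" "4 * v * k * (\<Sum>j<p. (b j)\<^sup>2) \<le> 1" using v \<rho> by (auto simp: k_def \<rho>_def[symmetric])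
  let ?G = "\<lambda>y. 1 - u * (lin b y * lin b y) + u\<^sup>2 / k\<^sup>2 * exp (k * (lin b y)\<^sup>2)"
  have G: "exp (- t * (lin b y)\<^sup>2) \<le> ?G y" for y
  proof -
    have "exp (- t * (lin b y)\<^sup>2) \<le> exp (- (u * (lin b y)\<^sup>2))"
      using u(2) by (simp add: mult_right_mono)
    also have "\<dots> \<le> 1 - u * (lin b y)\<^sup>2 + (u * (lin b y)\<^sup>2)\<^sup>2 / 2"
      using u by (intro exp_minus_le_quadratic) auto
    also have "(u * (lin b y)\<^sup>2)\<^sup>2 / 2 = u\<^sup>2 / k\<^sup>2 * ((k * (lin b y)\<^sup>2)\<^sup>2 / 2)"
      using k(1) by (simp add: power_mult_distrib)
    also have "\<dots> \<le> u\<^sup>2 / k\<^sup>2 * exp (k * (lin b y)\<^sup>2)"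
      using k(1) by (intro mult_left_mono square_le_exp) auto
    finally show ?thesis by (simp add: power2_eq_square)
  qed
  have int: "integrable \<mu> (\<lambda>y. exp (k * (lin b y)\<^sup>2))"
    using k by (intro integrable_exp_lin_square) auto
  have int_G: "integrable \<mu> ?G" using int integrable_lin_mult[of b b] by simp
  have "(\<integral>\<^sup>+y. ennreal (exp (- t * (lin b y)\<^sup>2)) \<partial>\<mu>) \<le> (\<integral>\<^sup>+y. ennreal (?G y) \<partial>\<mu>)"
    using G by (intro nn_integral_mono ennreal_leI) auto
  also have "\<dots> = ennreal (\<integral>y. ?G y \<partial>\<mu>)"
    using G by (intro nn_integral_eq_integral int_G AE_I2) (auto intro: order_trans[OF exp_ge_zero])
  also have "(\<integral>y. ?G y \<partial>\<mu>) = 1 - u * \<rho> + u\<^sup>2 / k\<^sup>2 * (\<integral>y. exp (k * (lin b y)\<^sup>2) \<partial>\<mu>)"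
    using int integrable_lin_mult[of b b] integral_lin_mult[of b b] prob_space[simplified]
    by (simp add: \<rho>_def power2_eq_square)
  also have "ennreal \<dots> \<le> ennreal (1 - u * \<rho> + u\<^sup>2 / k\<^sup>2 * 2)"
    using k by (intro ennreal_leI add_left_mono mult_left_mono integral_exp_lin_square_le) auto
  \<comment> \<open>Since 1 / k = 4 v \<rho>, the error 2 u^2 / k^2 is 32 v^2 x^2, which 64 v^2 x
    \<le> 1 bounds by x / 2.\<close>
  also have "1 - u * \<rho> + u\<^sup>2 / k\<^sup>2 * 2 = 1 - x + 32 * v\<^sup>2 * x\<^sup>2"
    by (simp add: k_def power_divide power_mult_distrib u(3)[symmetric])
  also have "\<dots> \<le> 1 - x / 2"
    using mult_right_mono[OF x(3) x(1)] by (simp add: power2_eq_square)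
  also have "\<dots> \<le> exp (- x / 2)" using exp_ge_add_one_self[of "- x / 2"] by simp
  finally show ?thesis by (simp add: ennreal_leI)
qed

end

section \<open>From one row to the whole design matrix\<close>

lemma sum_signal_mult:
  fixes X :: "nat \<times> nat \<Rightarrow> real"
  shows "(\<Sum>i<n. (\<Sum>j<p. X (i, j) * b j) * (\<Sum>k<p. X (i, k) * c k))
     = (\<Sum>j<p. \<Sum>k<p. b j * (\<Sum>i<n. X (i, j) * X (i, k)) * c k)"
proof -
  have "(\<Sum>i<n. (\<Sum>j<p. X (i, j) * b j) * (\<Sum>k<p. X (i, k) * c k))
      = (\<Sum>i<n. \<Sum>j<p. \<Sum>k<p. b j * (X (i, j) * X (i, k)) * c k)"
    by (simp add: sum_product mult_ac)
  also have "\<dots> = (\<Sum>j<p. \<Sum>k<p. \<Sum>i<n. b j * (X (i, j) * X (i, k)) * c k)"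
    by (rule trans[OF sum.swap sum.cong[OF refl]], rule sum.swap)
  finally show ?thesis by (simp add: sum_distrib_left sum_distrib_right mult_ac)
qed

lemma subG_designE:
  assumes "subG_design \<sigma>2 n p D"
  obtains \<mu> where "subgaussian_row \<mu> p (max 1 \<sigma>2)" "design D n p"
    "D = distr (PiM {..<n} (\<lambda>_. \<mu>)) (design_space n p) (\<lambda>R. \<lambda>ij\<in>{..<n} \<times> {..<p}. R (fst ij) (snd ij))"
    "(\<lambda>R. \<lambda>ij\<in>{..<n} \<times> {..<p}. R (fst ij) (snd ij)) \<in> measurable (PiM {..<n} (\<lambda>_. \<mu>)) (design_space n p)"
    "AE X in D. \<forall>v. (\<exists>j<p. v j \<noteq> 0) \<longrightarrow> 0 < (\<Sum>i<n. (\<Sum>j<p. X (i, j) * v j)\<^sup>2)"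
proof -
  from assms obtain \<mu> where \<mu>: "prob_space \<mu>" "sets \<mu> = sets (vec_space p)"
    and D: "D = distr (PiM {..<n} (\<lambda>_. \<mu>)) (design_space n p) (\<lambda>R. \<lambda>ij\<in>{..<n} \<times> {..<p}. R (fst ij) (snd ij))"
    and mom: "\<And>j k. j < p \<Longrightarrow> k < p \<Longrightarrow> integrable \<mu> (\<lambda>x. x j * x k) \<and> (\<integral>x. x j * x k \<partial>\<mu>) = (if j = k then 1 else 0)"
    and mgf: "\<And>u t. (\<Sum>j<p. (u j)\<^sup>2) = 1 \<Longrightarrow>
       integrable \<mu> (\<lambda>x. exp (t * (\<Sum>j<p. u j * x j))) \<and>
       ln (\<integral>x. exp (t * (\<Sum>j<p. u j * x j)) \<partial>\<mu>) \<le> \<sigma>2 * t\<^sup>2 / 2"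
    and pd: "AE X in D. \<forall>v::nat \<Rightarrow> real. (\<exists>j<p. v j \<noteq> 0) \<longrightarrow>
         (\<Sum>j<p. \<Sum>k<p. v j * (\<Sum>i<n. X (i, j) * X (i, k)) * v k) > 0"
    unfolding subG_design_def by blast
  have row: "subgaussian_row \<mu> p (max 1 \<sigma>2)"
  proof (rule subgaussian_row.intro)
    show "prob_space \<mu>" "sets \<mu> = sets (vec_space p)" by (fact \<mu>)+
    show "integrable \<mu> (\<lambda>x. x j * x k)" "(\<integral>x. x j * x k \<partial>\<mu>) = (if j = k then 1 else 0)"
      if "j < p" "k < p" for j k using mom[OF that] by (rule conjunct1, rule conjunct2)
    show "1 \<le> max 1 \<sigma>2" by (rule max.cobounded1)
    fix u :: "nat \<Rightarrow> real" and t assume u: "(\<Sum>j<p. (u j)\<^sup>2) = 1"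
    have "\<sigma>2 * t\<^sup>2 / 2 \<le> max 1 \<sigma>2 * t\<^sup>2 / 2" by (intro divide_right_mono mult_right_mono) auto
    then show "integrable \<mu> (\<lambda>x. exp (t * (\<Sum>j<p. u j * x j))) \<and>
       ln (\<integral>x. exp (t * (\<Sum>j<p. u j * x j)) \<partial>\<mu>) \<le> max 1 \<sigma>2 * t\<^sup>2 / 2"
      using mgf[OF u, of t] by linarith
  qed
  have meas: "(\<lambda>R. \<lambda>ij\<in>{..<n} \<times> {..<p}. R (fst ij) (snd ij)) \<in> measurable (PiM {..<n} (\<lambda>_. \<mu>)) (design_space n p)"
    unfolding design_space_def
  proof (rule measurable_restrict)
    fix ij assume ij: "ij \<in> {..<n} \<times> {..<p}"
    have "(\<lambda>x. x (snd ij)) \<in> borel_measurable \<mu>"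
      using measurable_vec_space_component[of "snd ij" p] ij \<mu>(2) by (auto cong: measurable_cong_sets)
    then show "(\<lambda>R. R (fst ij) (snd ij)) \<in> borel_measurable (PiM {..<n} (\<lambda>_. \<mu>))"
      using ij by (intro measurable_compose[OF measurable_component_singleton]) auto
  qed
  have "prob_space D"
    unfolding D using \<mu>(1) by (intro prob_space.prob_space_distr[OF prob_space_PiM] meas)
  then have des: "design D n p" unfolding design_def D by simp
  have "AE X in D. \<forall>v. (\<exists>j<p. v j \<noteq> 0) \<longrightarrow> 0 < (\<Sum>i<n. (\<Sum>j<p. X (i, j) * v j)\<^sup>2)"
    using pd by eventually_elim (simp add: power2_eq_square sum_signal_mult)
  from that[OF row des D meas this] show thesis .
qed

text \<open>Independence of the rows turns the integral into an n-th power. \<open>F\<close> has to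
  ignore indices from p on, because a row of the restricted matrix is only guaranteed to agree with
  the sampled row below p.\<close>

lemma nn_integral_rows:
  assumes \<mu>: "prob_space \<mu>" "sets \<mu> = sets (vec_space p)"
    and D: "D = distr (PiM {..<n} (\<lambda>_. \<mu>)) (design_space n p) (\<lambda>R. \<lambda>ij\<in>{..<n} \<times> {..<p}. R (fst ij) (snd ij))"
    and meas: "(\<lambda>R. \<lambda>ij\<in>{..<n} \<times> {..<p}. R (fst ij) (snd ij)) \<in> measurable (PiM {..<n} (\<lambda>_. \<mu>)) (design_space n p)"
    and F: "F \<in> borel_measurable (vec_space p)" "\<And>x y. (\<And>j. j < p \<Longrightarrow> x j = y j) \<Longrightarrow> F x = F y"
    and F': "(\<lambda>X. \<Sum>i<n. F (\<lambda>j. X (i, j))) \<in> borel_measurable (design_space n p)"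
    and le: "(\<integral>\<^sup>+x. ennreal (exp (F x)) \<partial>\<mu>) \<le> ennreal (exp K)"
  shows "(\<integral>\<^sup>+X. ennreal (exp (\<Sum>i<n. F (\<lambda>j. X (i, j)))) \<partial>D) \<le> ennreal (exp (real n * K))"
proof -
  interpret product_sigma_finite "\<lambda>_::nat. \<mu>"
    unfolding product_sigma_finite_def using \<mu>(1) prob_space_imp_sigma_finite by blast
  have [measurable]: "F \<in> borel_measurable \<mu>" using F(1) \<mu>(2) by (simp cong: measurable_cong_sets)
  have row: "F (\<lambda>j. (\<lambda>ij\<in>{..<n} \<times> {..<p}. R (fst ij) (snd ij)) (i, j)) = F (R i)" if "i < n" for i R
    using that by (intro F(2)) auto
  have "(\<integral>\<^sup>+X. ennreal (exp (\<Sum>i<n. F (\<lambda>j. X (i, j)))) \<partial>D)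
      = (\<integral>\<^sup>+R. ennreal (exp (\<Sum>i<n. F (R i))) \<partial>PiM {..<n} (\<lambda>_. \<mu>))"
  proof -
    have "(\<integral>\<^sup>+X. ennreal (exp (\<Sum>i<n. F (\<lambda>j. X (i, j)))) \<partial>D)
      = (\<integral>\<^sup>+R. ennreal (exp (\<Sum>i<n. F (\<lambda>j. (\<lambda>ij\<in>{..<n} \<times> {..<p}. R (fst ij) (snd ij)) (i, j)))) \<partial>PiM {..<n} (\<lambda>_. \<mu>))"
      unfolding D using measurable_compose[OF F', of "\<lambda>x. ennreal (exp x)" borel]
      by (intro nn_integral_distr meas) simp
    also have "\<dots> = (\<integral>\<^sup>+R. ennreal (exp (\<Sum>i<n. F (R i))) \<partial>PiM {..<n} (\<lambda>_. \<mu>))"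
      by (intro nn_integral_cong arg_cong[where f = "\<lambda>x. ennreal (exp x)"] sum.cong refl row) simp
    finally show ?thesis .
  qed
  also have "\<dots> = (\<integral>\<^sup>+R. (\<Prod>i<n. ennreal (exp (F (R i)))) \<partial>PiM {..<n} (\<lambda>_. \<mu>))"
    by (simp add: exp_sum prod_ennreal)
  also have "\<dots> = (\<integral>\<^sup>+x. ennreal (exp (F x)) \<partial>\<mu>) ^ n"
    by (subst product_nn_integral_prod) auto
  also have "\<dots> \<le> ennreal (exp K) ^ n" using le by (rule power_mono) simp
  also have "\<dots> = ennreal (exp (real n * K))" by (simp add: ennreal_power exp_of_nat_mult)
  finally show ?thesis .
qed

section \<open>Regular designs and the prior\<close>

text \<open>The interface between the design classes and the risk bounds. \<open>laplace_le\<close>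
  controls the type II error of the test, with x a truncated energy per row;
  \<open>exp_inner_le\<close> controls the second moment of the likelihood ratio, and its term in
  \<rho>^2 accounts for the fluctuation of X^T X around n I.\<close>

locale regular_design = design +
  fixes v :: real
  assumes v_ge_1: "1 \<le> v"
    and pos_def: "AE X in D. \<forall>b. (\<exists>j<p. b j \<noteq> 0) \<longrightarrow> 0 < (\<Sum>i<n. (\<Sum>j<p. X (i, j) * b j)\<^sup>2)"
    and laplace_le: "\<And>b t x. 0 \<le> t \<Longrightarrow> 0 \<le> x \<Longrightarrow> x \<le> t * (\<Sum>j<p. (b j)\<^sup>2) \<Longrightarrow> 64 * v\<^sup>2 * x \<le> 1 \<Longrightarrow>
      (\<integral>X. exp (- t * (\<Sum>i<n. (\<Sum>j<p. X (i, j) * b j)\<^sup>2)) \<partial>D) \<le> exp (- (real n * x / 2))"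
    and exp_inner_le: "\<And>b c \<rho>. 0 < \<rho> \<Longrightarrow> 8 * v * \<rho> \<le> 1 \<Longrightarrow> (\<Sum>j<p. (b j)\<^sup>2) \<le> \<rho> \<Longrightarrow> (\<Sum>j<p. (c j)\<^sup>2) \<le> \<rho> \<Longrightarrow>
      (\<integral>\<^sup>+X. ennreal (exp (\<Sum>i<n. (\<Sum>j<p. X (i, j) * b j) * (\<Sum>j<p. X (i, j) * c j))) \<partial>D)
        \<le> ennreal (exp (real n * (\<Sum>j<p. b j * c j) + 128 * v\<^sup>2 * real n * \<rho>\<^sup>2))"

lemma subG_regular:
  assumes "subG_design \<sigma>2 n p D"
  shows "regular_design D n p (max 1 \<sigma>2)"
proof -
  from subG_designE[OF assms] obtain \<mu> where row: "subgaussian_row \<mu> p (max 1 \<sigma>2)" and des: "design D n p"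
    and D: "D = distr (PiM {..<n} (\<lambda>_. \<mu>)) (design_space n p) (\<lambda>R. \<lambda>ij\<in>{..<n} \<times> {..<p}. R (fst ij) (snd ij))"
    and meas: "(\<lambda>R. \<lambda>ij\<in>{..<n} \<times> {..<p}. R (fst ij) (snd ij)) \<in> measurable (PiM {..<n} (\<lambda>_. \<mu>)) (design_space n p)"
    and pd: "AE X in D. \<forall>v. (\<exists>j<p. v j \<noteq> 0) \<longrightarrow> 0 < (\<Sum>i<n. (\<Sum>j<p. X (i, j) * v j)\<^sup>2)" .
  interpret subgaussian_row \<mu> p "max 1 \<sigma>2" by (rule row)
  interpret design D n p by (rule des)
  note rows = nn_integral_rows[OF prob_row sets_row D meas]
  show ?thesis
  proof (intro regular_design.intro regular_design_axioms.intro des pd)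
    show "1 \<le> max 1 \<sigma>2" by simp
  next
    fix b :: "nat \<Rightarrow> real" and t x :: real
    assume tx: "0 \<le> t" "0 \<le> x" "x \<le> t * (\<Sum>j<p. (b j)\<^sup>2)" "64 * (max 1 \<sigma>2)\<^sup>2 * x \<le> 1"
    have "(\<integral>\<^sup>+X. ennreal (exp (\<Sum>i<n. - t * (lin b (\<lambda>j. X (i, j)))\<^sup>2)) \<partial>D) \<le> ennreal (exp (real n * (- x / 2)))"
    proof (rule rows)
      show "(\<lambda>X. \<Sum>i<n. - t * (lin b (\<lambda>j. X (i, j)))\<^sup>2) \<in> borel_measurable (design_space n p)"
        unfolding lin_def by measurable
      show "- t * (lin b x)\<^sup>2 = - t * (lin b y)\<^sup>2" if "\<And>j. j < p \<Longrightarrow> x j = y j" for x y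
        using that by (simp add: lin_def)
      show "(\<integral>\<^sup>+y. ennreal (exp (- t * (lin b y)\<^sup>2)) \<partial>\<mu>) \<le> ennreal (exp (- x / 2))"
        by (rule nn_integral_exp_minus_lin_square_le[OF tx])
    qed measurable
    then show "(\<integral>X. exp (- t * (\<Sum>i<n. (\<Sum>j<p. X (i, j) * b j)\<^sup>2)) \<partial>D) \<le> exp (- (real n * x / 2))"
      by (intro integral_real_bounded) (simp_all add: lin_def sum_distrib_left sum_negf)
  next
    fix b c :: "nat \<Rightarrow> real" and \<rho> :: real
    assume bc: "0 < \<rho>" "8 * max 1 \<sigma>2 * \<rho> \<le> 1" "(\<Sum>j<p. (b j)\<^sup>2) \<le> \<rho>" "(\<Sum>j<p. (c j)\<^sup>2) \<le> \<rho>"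
    have "(\<integral>\<^sup>+X. ennreal (exp (\<Sum>i<n. lin b (\<lambda>j. X (i, j)) * lin c (\<lambda>j. X (i, j)))) \<partial>D)
      \<le> ennreal (exp (real n * ((\<Sum>j<p. b j * c j) + 128 * (max 1 \<sigma>2)\<^sup>2 * \<rho>\<^sup>2)))"
    proof (rule rows)
      show "(\<lambda>X. \<Sum>i<n. lin b (\<lambda>j. X (i, j)) * lin c (\<lambda>j. X (i, j))) \<in> borel_measurable (design_space n p)"
        unfolding lin_def by measurable
      show "lin b x * lin c x = lin b y * lin c y" if "\<And>j. j < p \<Longrightarrow> x j = y j" for x y
        using that by (simp add: lin_def)
      show "(\<integral>\<^sup>+y. ennreal (exp (lin b y * lin c y)) \<partial>\<mu>) \<le> ennreal (exp ((\<Sum>j<p. b j * c j) + 128 * (max 1 \<sigma>2)\<^sup>2 * \<rho>\<^sup>2))"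
        by (rule nn_integral_exp_lin_mult_le[OF bc])
    qed measurable
    then show "(\<integral>\<^sup>+X. ennreal (exp (\<Sum>i<n. (\<Sum>j<p. X (i, j) * b j) * (\<Sum>j<p. X (i, j) * c j))) \<partial>D)
        \<le> ennreal (exp (real n * (\<Sum>j<p. b j * c j) + 128 * (max 1 \<sigma>2)\<^sup>2 * real n * \<rho>\<^sup>2))"
      unfolding lin_def distrib_left by (simp add: mult_ac)
  qed
qed

text \<open>X^T X = n I turns |X b|^2 and <X b, X c> into the constants n |b|^2 and n <b, c>, so v =
  1 serves. From p \<le> n it follows that n is positive as soon as there is a column, which gives
  positive definiteness.\<close>

lemma orth_regular:
  assumes orth: "orth_design n p D" and pn: "p \<le> n"
  shows "regular_design D n p 1"
proof -
  have des: "design D n p" using orth unfolding orth_design_def design_def by simp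
  interpret design D n p by (rule des)
  have gram: "AE X in D. \<forall>b c. (\<Sum>i<n. (\<Sum>j<p. X (i, j) * b j) * (\<Sum>k<p. X (i, k) * c k)) = real n * (\<Sum>j<p. b j * c j)"
  proof -
    have "AE X in D. \<forall>j<p. \<forall>k<p. (\<Sum>i<n. X (i, j) * X (i, k)) = (if j = k then real n else 0)"
      using orth unfolding orth_design_def by blast
    then show ?thesis
    proof eventually_elim
      case (elim X)
      show ?case
      proof (intro allI)
        fix b c :: "nat \<Rightarrow> real"
        have "(\<Sum>j<p. \<Sum>k<p. b j * (\<Sum>i<n. X (i, j) * X (i, k)) * c k) = (\<Sum>j<p. \<Sum>k<p. if j = k then real n * (b j * c k) else 0)"
          using elim by (intro sum.cong refl) simp
        then show "(\<Sum>i<n. (\<Sum>j<p. X (i, j) * b j) * (\<Sum>k<p. X (i, k) * c k)) = real n * (\<Sum>j<p. b j * c j)"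
          unfolding sum_signal_mult by (simp add: sum_distrib_left)
      qed
    qed
  qed
  have gram2: "AE X in D. \<forall>b. (\<Sum>i<n. (\<Sum>j<p. X (i, j) * b j)\<^sup>2) = real n * (\<Sum>j<p. (b j)\<^sup>2)"
    using gram by eventually_elim (simp add: power2_eq_square)
  show ?thesis
  proof (intro regular_design.intro regular_design_axioms.intro des)
    show "AE X in D. \<forall>b. (\<exists>j<p. b j \<noteq> 0) \<longrightarrow> 0 < (\<Sum>i<n. (\<Sum>j<p. X (i, j) * b j)\<^sup>2)"
      using gram2
    proof eventually_elim
      case (elim X)
      show ?case
      proof (intro allI impI)
        fix b :: "nat \<Rightarrow> real" assume "\<exists>j<p. b j \<noteq> 0"
        then obtain j where j: "j < p" "b j \<noteq> 0" by blast
        have "0 < (\<Sum>j<p. (b j)\<^sup>2)" using j by (intro sum_pos2[of _ j]) auto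
        moreover have "0 < real n" using j pn by simp
        ultimately show "0 < (\<Sum>i<n. (\<Sum>j<p. X (i, j) * b j)\<^sup>2)" unfolding elim[rule_format] by simp
      qed
    qed
  next
    fix b :: "nat \<Rightarrow> real" and t x :: real
    assume tx: "0 \<le> t" "0 \<le> x" "x \<le> t * (\<Sum>j<p. (b j)\<^sup>2)"
    have "(\<integral>X. exp (- t * (\<Sum>i<n. (\<Sum>j<p. X (i, j) * b j)\<^sup>2)) \<partial>D) = (\<integral>X. exp (- t * (real n * (\<Sum>j<p. (b j)\<^sup>2))) \<partial>D)"
    proof (intro integral_cong_AE)
      show "AE X in D. exp (- t * (\<Sum>i<n. (\<Sum>j<p. X (i, j) * b j)\<^sup>2)) = exp (- t * (real n * (\<Sum>j<p. (b j)\<^sup>2)))"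
        using gram2 by eventually_elim simp
    qed measurable
    also have "\<dots> = exp (- (real n * (t * (\<Sum>j<p. (b j)\<^sup>2))))"
      using D.prob_space by (simp add: mult_ac)
    also have "\<dots> \<le> exp (- (real n * x / 2))"
    proof -
      have "real n * (x / 2) \<le> real n * (t * (\<Sum>j<p. (b j)\<^sup>2))"
        using tx by (intro mult_left_mono) auto
      then show ?thesis by simp
    qed
    finally show "(\<integral>X. exp (- t * (\<Sum>i<n. (\<Sum>j<p. X (i, j) * b j)\<^sup>2)) \<partial>D) \<le> exp (- (real n * x / 2))" .
  next
    fix b c :: "nat \<Rightarrow> real" and \<rho> :: real
    have "(\<integral>\<^sup>+X. ennreal (exp (\<Sum>i<n. (\<Sum>j<p. X (i, j) * b j) * (\<Sum>j<p. X (i, j) * c j))) \<partial>D)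
      = (\<integral>\<^sup>+X. ennreal (exp (real n * (\<Sum>j<p. b j * c j))) \<partial>D)"
    proof (intro nn_integral_cong_AE)
      show "AE X in D. ennreal (exp (\<Sum>i<n. (\<Sum>j<p. X (i, j) * b j) * (\<Sum>j<p. X (i, j) * c j)))
          = ennreal (exp (real n * (\<Sum>j<p. b j * c j)))"
        using gram by eventually_elim simp
    qed
    also have "\<dots> = ennreal (exp (real n * (\<Sum>j<p. b j * c j)))"
      using D.emeasure_space_1 by simp
    also have "\<dots> \<le> ennreal (exp (real n * (\<Sum>j<p. b j * c j) + 128 * 1\<^sup>2 * real n * \<rho>\<^sup>2))"
      by (intro ennreal_leI) simp
    finally show "(\<integral>\<^sup>+X. ennreal (exp (\<Sum>i<n. (\<Sum>j<p. X (i, j) * b j) * (\<Sum>j<p. X (i, j) * c j))) \<partial>D)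
      \<le> ennreal (exp (real n * (\<Sum>j<p. b j * c j) + 128 * 1\<^sup>2 * real n * \<rho>\<^sup>2))" .
  qed simp
qed

text \<open>The coordinates below s * m form s residue classes modulo s of size m; the prior picks one
  coordinate of each class and a sign, independently. The overlap of two draws is then a sum of
  independent terms, which avoids the hypergeometric overlap of uniformly drawn supports.\<close>

definition prior_index :: "nat \<Rightarrow> nat \<Rightarrow> (nat \<Rightarrow> nat \<times> real) set" where
  "prior_index s m = PiE {..<s} (\<lambda>_. {..<m} \<times> {1, - 1})"

definition prior_vec :: "nat \<Rightarrow> nat \<Rightarrow> real \<Rightarrow> (nat \<Rightarrow> nat \<times> real) \<Rightarrow> nat \<Rightarrow> real" where
  "prior_vec s m A f j = (if j < s * m \<and> fst (f (j mod s)) = j div s then A * snd (f (j mod s)) else 0)"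

definition overlap :: "nat \<times> real \<Rightarrow> nat \<times> real \<Rightarrow> real" where
  "overlap u w = (if fst u = fst w then snd u * snd w else 0)"

lemma finite_prior_index: "finite (prior_index s m)"
  unfolding prior_index_def by (intro finite_PiE) auto

lemma card_prior_index: "card (prior_index s m) = (2 * m) ^ s"
proof -
  have "card ({..<m} \<times> {1, - 1 :: real}) = 2 * m" by (simp add: card_cartesian_product)
  then show ?thesis unfolding prior_index_def by (simp only: card_PiE finite_lessThan prod_constant card_lessThan)
qed

lemma sum_residue_classes:
  assumes "s * m \<le> p" "\<And>j. s * m \<le> j \<Longrightarrow> F j = 0"
  shows "(\<Sum>j<p. F j) = (\<Sum>q<s. \<Sum>r<m. F (q + s * r :: nat) :: 'a :: comm_monoid_add)"
proof -
  have "(\<Sum>j<p. F j) = (\<Sum>j<s * m. F j)"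
    using assms by (intro sum.mono_neutral_right) auto
  also have "\<dots> = (\<Sum>(q, r)\<in>{..<s} \<times> {..<m}. F (q + s * r))"
  proof (rule sum.reindex_bij_witness[of _ "\<lambda>(q, r). q + s * r" "\<lambda>j. (j mod s, j div s)"])
    fix j assume j: "j \<in> {..<s * m}"
    then have "0 < s" by (cases s) auto
    with j show "(j mod s, j div s) \<in> {..<s} \<times> {..<m}"
      by (simp add: less_mult_imp_div_less mult.commute)
  next
    fix x assume "x \<in> {..<s} \<times> {..<m}"
    then obtain q r where x: "x = (q, r)" and qr: "q < s" "Suc r \<le> m" by auto
    have "q + s * r < s * Suc r" using qr by simp
    also have "\<dots> \<le> s * m" using qr(2) by (rule mult_le_mono2)
    finally show "(case x of (q, r) \<Rightarrow> q + s * r) \<in> {..<s * m}" by (simp add: x)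
    show "((case x of (q, r) \<Rightarrow> q + s * r) mod s, (case x of (q, r) \<Rightarrow> q + s * r) div s) = x"
      using qr by (simp add: x)
  qed auto
  finally show ?thesis by (simp add: sum.cartesian_product)
qed

lemma prior_vec_class:
  assumes "q < s" "r < m"
  shows "prior_vec s m A f (q + s * r) = (if fst (f q) = r then A * snd (f q) else 0)"
proof -
  have "q + s * r < s * Suc r" using assms by simp
  also have "\<dots> \<le> s * m" using assms by (intro mult_le_mono2) simp
  finally have "q + s * r < s * m" .
  moreover have "(q + s * r) mod s = q" "(q + s * r) div s = r" using assms by simp_all
  ultimately show ?thesis by (simp only: prior_vec_def) simp
qed

lemma prior_index_component:
  assumes "f \<in> prior_index s m" "q < s"
  shows "fst (f q) < m" "(snd (f q))\<^sup>2 = 1"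
proof -
  have "f q \<in> {..<m} \<times> {1, - 1}"
    using PiE_mem[OF assms(1)[unfolded prior_index_def], of q] assms(2) by simp
  then have "fst (f q) < m" "snd (f q) = 1 \<or> snd (f q) = - 1" by (auto simp: mem_Times_iff)
  then show "fst (f q) < m" "(snd (f q))\<^sup>2 = 1" by (auto simp: power2_eq_1_iff)
qed

lemma prior_vec_inner:
  assumes "s * m \<le> p" and f: "f \<in> prior_index s m"
  shows "(\<Sum>j<p. prior_vec s m A f j * prior_vec s m A g j) = A\<^sup>2 * (\<Sum>q<s. overlap (f q) (g q))"
proof -
  have "(\<Sum>j<p. prior_vec s m A f j * prior_vec s m A g j)
      = (\<Sum>q<s. \<Sum>r<m. prior_vec s m A f (q + s * r) * prior_vec s m A g (q + s * r))"
    using assms(1) by (rule sum_residue_classes) (simp add: prior_vec_def)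
  also have "\<dots> = (\<Sum>q<s. \<Sum>r<m. if fst (f q) = r then A\<^sup>2 * overlap (f q) (g q) else 0)"
    by (intro sum.cong refl) (auto simp: prior_vec_class overlap_def power2_eq_square)
  also have "\<dots> = A\<^sup>2 * (\<Sum>q<s. overlap (f q) (g q))"
    using prior_index_component(1)[OF f] by (simp add: sum_distrib_left)
  finally show ?thesis .
qed

lemma prior_vec_norm:
  assumes "s * m \<le> p" "f \<in> prior_index s m"
  shows "(\<Sum>j<p. (prior_vec s m A f j)\<^sup>2) = real s * A\<^sup>2"
proof -
  have "overlap (f q) (f q) = 1" if "q < s" for q
    using prior_index_component(2)[OF assms(2) that] by (simp add: overlap_def power2_eq_square)
  then show ?thesis using prior_vec_inner[OF assms, of A f] by (simp add: power2_eq_square)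
qed

lemma prior_vec_in_Xi:
  assumes sm: "s * m \<le> p" and f: "f \<in> prior_index s m" and A: "0 < A"
  shows "prior_vec s m A f \<in> Xi p s A"
proof -
  let ?b = "prior_vec s m A f"
  have val: "\<bar>?b j\<bar> = A" if "?b j \<noteq> 0" for j
  proof -
    from that have j: "j < s * m" "?b j = A * snd (f (j mod s))" by (auto simp: prior_vec_def split: if_splits)
    then have "j mod s < s" by (cases s) auto
    from prior_index_component(2)[OF f this] have "\<bar>snd (f (j mod s))\<bar> = 1"
      by (simp add: power2_eq_1_iff) auto
    then show ?thesis using j A by (simp add: abs_mult)
  qed
  \<comment> \<open>The support size is read off from the norm: all nonzero entries have modulus A,
    so A^2 times their number is the squared norm s A^2.\<close>
  have "A\<^sup>2 * real (card {j. j < p \<and> ?b j \<noteq> 0}) = (\<Sum>j | j < p \<and> ?b j \<noteq> 0. A\<^sup>2)" by simp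
  also have "\<dots> = (\<Sum>j | j < p \<and> ?b j \<noteq> 0. (?b j)\<^sup>2)"
    using val by (intro sum.cong refl) (metis (mono_tags, lifting) mem_Collect_eq power2_abs)
  also have "\<dots> = (\<Sum>j<p. (?b j)\<^sup>2)"
    by (intro sum.mono_neutral_left) auto
  also have "\<dots> = A\<^sup>2 * real s" using prior_vec_norm[OF sm f] by simp
  finally have "card {j. j < p \<and> ?b j \<noteq> 0} = s" using A by simp
  moreover have "?b j = 0" if "p \<le> j" for j using that sm by (simp add: prior_vec_def)
  ultimately show ?thesis unfolding Xi_def using val by (auto simp: order.order_iff_strict)
qed

text \<open>Within one class, two draws choose the same position with probability 1 / m, and their
  random signs then average exp to cosh. The term linear in \<tau> thus disappears.\<close>

lemma sum_exp_overlap: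
  assumes "0 < m"
  shows "(\<Sum>u\<in>{..<m} \<times> {1, - 1}. \<Sum>w\<in>{..<m} \<times> {1, - 1}. exp (\<tau> * overlap u w))
     = (real (2 * m))\<^sup>2 * (1 + (cosh \<tau> - 1) / real m)"
proof -
  have inner: "(\<Sum>w\<in>{..<m} \<times> {1, - 1}. exp (\<tau> * overlap u w)) = 2 * real m + 2 * (cosh \<tau> - 1)"
    if u: "u \<in> {..<m} \<times> {1, - 1}" for u
  proof -
    have "(\<Sum>w\<in>{..<m} \<times> {1, - 1}. exp (\<tau> * overlap u w))
        = (\<Sum>r<m. \<Sum>e\<in>{1, - 1}. exp (\<tau> * overlap u (r, e)))"
      by (rule sum.cartesian_product')
    also have "\<dots> = (\<Sum>r<m. 2 + (if fst u = r then 2 * (cosh \<tau> - 1) else 0))"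
      using u by (intro sum.cong refl) (auto simp: overlap_def cosh_def)
    also have "\<dots> = 2 * real m + 2 * (cosh \<tau> - 1)"
      using u by (auto simp: sum.distrib)
    finally show ?thesis .
  qed
  have "(\<Sum>u\<in>{..<m} \<times> {1, - 1}. \<Sum>w\<in>{..<m} \<times> {1, - 1}. exp (\<tau> * overlap u w))
      = (\<Sum>u\<in>{..<m} \<times> {1, - 1 :: real}. 2 * real m + 2 * (cosh \<tau> - 1))"
    by (intro sum.cong refl inner)
  also have "\<dots> = (real (2 * m))\<^sup>2 * (1 + (cosh \<tau> - 1) / real m)"
    using assms by (simp add: card_cartesian_product field_simps power2_eq_square)
  finally show ?thesis .
qed

lemma cosh_le_one_plus_square:
  fixes \<tau> :: real assumes "0 \<le> \<tau>" "\<tau> \<le> 1" shows "cosh \<tau> \<le> 1 + \<tau>\<^sup>2"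
proof -
  have "exp \<tau> + exp (- \<tau>) \<le> 2 * (1 + \<tau>\<^sup>2)"
  proof -
    have "a + b \<le> 2 * (1 + y)" if "a \<le> 1 + \<tau> + y" "b \<le> 1 - \<tau> + y / 2" "0 \<le> y" for a b y :: real
      using that by simp
    from this[OF exp_bound[OF assms] exp_minus_le_quadratic[OF assms(1)] zero_le_power2] show ?thesis .
  qed
  then show ?thesis by (simp add: cosh_def)
qed

text \<open>The choices in different classes are independent, so the double sum over draws
  factorises into the s-th power of the sum for one class.\<close>

lemma sum_exp_prior_inner_le:
  assumes sm: "s * m \<le> p" and m: "0 < m" and \<tau>: "0 \<le> N * A\<^sup>2" "N * A\<^sup>2 \<le> 1"
  shows "(\<Sum>f\<in>prior_index s m. \<Sum>g\<in>prior_index s m.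
       exp (N * (\<Sum>j<p. prior_vec s m A f j * prior_vec s m A g j)))
     \<le> (real (card (prior_index s m)))\<^sup>2 * exp (real s * (N * A\<^sup>2)\<^sup>2 / real m)"
proof -
  define \<tau> where "\<tau> = N * A\<^sup>2"
  let ?V = "{..<m} \<times> {1, - 1 :: real}"
  have "(\<Sum>f\<in>prior_index s m. \<Sum>g\<in>prior_index s m. exp (N * (\<Sum>j<p. prior_vec s m A f j * prior_vec s m A g j)))
      = (\<Sum>f\<in>prior_index s m. \<Sum>g\<in>prior_index s m. \<Prod>q<s. exp (\<tau> * overlap (f q) (g q)))"
    by (intro sum.cong refl)
       (simp add: prior_vec_inner[OF sm] \<tau>_def exp_sum[symmetric] sum_distrib_left mult.assoc)
  also have "\<dots> = (\<Sum>f\<in>prior_index s m. \<Prod>q<s. \<Sum>w\<in>?V. exp (\<tau> * overlap (f q) w))"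
    unfolding prior_index_def by (intro sum.cong refl prod_sum_PiE[symmetric]) auto
  also have "\<dots> = (\<Prod>q<s. \<Sum>u\<in>?V. \<Sum>w\<in>?V. exp (\<tau> * overlap u w))"
    unfolding prior_index_def by (intro prod_sum_PiE[symmetric]) auto
  also have "\<dots> = ((real (2 * m))\<^sup>2 * (1 + (cosh \<tau> - 1) / real m)) ^ s"
    unfolding sum_exp_overlap[OF m] by simp
  also have "\<dots> = (real (card (prior_index s m)))\<^sup>2 * (1 + (cosh \<tau> - 1) / real m) ^ s"
    unfolding card_prior_index of_nat_power
    by (simp only: power_mult_distrib power_mult[symmetric] mult.commute[of s 2])
  also have "\<dots> \<le> (real (card (prior_index s m)))\<^sup>2 * exp (\<tau>\<^sup>2 / real m) ^ s"
  proof (intro mult_left_mono power_mono)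
    have "1 + (cosh \<tau> - 1) / real m \<le> 1 + \<tau>\<^sup>2 / real m"
      using cosh_le_one_plus_square[of \<tau>] assms m by (simp add: \<tau>_def divide_right_mono)
    also have "\<dots> \<le> exp (\<tau>\<^sup>2 / real m)" by (rule exp_ge_add_one_self)
    finally show "1 + (cosh \<tau> - 1) / real m \<le> exp (\<tau>\<^sup>2 / real m)" .
    show "0 \<le> 1 + (cosh \<tau> - 1) / real m" using cosh_real_ge_1[of \<tau>] by (simp add: add_nonneg_nonneg)
  qed auto
  also have "exp (\<tau>\<^sup>2 / real m) ^ s = exp (real s * \<tau>\<^sup>2 / real m)"
    by (simp add: exp_of_nat_mult[symmetric])
  finally show ?thesis by (simp add: \<tau>_def)
qed

section \<open>Rates\<close>

definition sparsity :: "real \<Rightarrow> nat \<Rightarrow> nat" where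
  "sparsity \<alpha> p = nat \<lfloor>real p powr (1 - \<alpha>)\<rfloor>"

text \<open>For a number that is at least 1, rounding down loses at most a factor 2, which is
  invisible on the logarithmic scale.\<close>

lemma sparsity_bounds:
  assumes "1 \<le> p" "0 \<le> \<alpha>" "\<alpha> \<le> 1"
  shows "real p powr (1 - \<alpha>) / 2 \<le> real (sparsity \<alpha> p)" "real (sparsity \<alpha> p) \<le> real p powr (1 - \<alpha>)"
    "1 \<le> sparsity \<alpha> p" "sparsity \<alpha> p \<le> p"
proof -
  have x: "1 \<le> real p powr (1 - \<alpha>)" using assms by (intro ge_one_powr_ge_zero) auto
  have f: "real_of_int \<lfloor>real p powr (1 - \<alpha>)\<rfloor> = real (sparsity \<alpha> p)"
    using x by (simp add: sparsity_def)
  show le: "real (sparsity \<alpha> p) \<le> real p powr (1 - \<alpha>)"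
    unfolding f[symmetric] by (rule of_int_floor_le)
  have "real p powr (1 - \<alpha>) < real (sparsity \<alpha> p) + 1"
    unfolding f[symmetric] by (rule floor_correct[THEN conjunct2, simplified])
  moreover from this x have "0 < real (sparsity \<alpha> p)" by linarith
  ultimately show "1 \<le> sparsity \<alpha> p" "real p powr (1 - \<alpha>) / 2 \<le> real (sparsity \<alpha> p)"
    by simp_all
  have "real p powr (1 - \<alpha>) \<le> real p powr 1" using assms by (intro powr_mono) auto
  then show "sparsity \<alpha> p \<le> p" using le assms(1) by simp
qed

lemma Xi_nonempty: "s \<le> p \<Longrightarrow> 0 < A \<Longrightarrow> Xi p s A \<noteq> {}"
proof -
  assume *: "s \<le> p" "0 < A"
  then have "{j. j < p \<and> (if j < s then A else 0) \<noteq> 0} = {..<s}" by auto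
  with * have "(\<lambda>j. if j < s then A else 0) \<in> Xi p s A" unfolding Xi_def by simp
  then show ?thesis by blast
qed

lemma Xi_norm_ge:
  assumes "\<beta> \<in> Xi p s A" "0 \<le> A"
  shows "real s * A\<^sup>2 \<le> (\<Sum>j<p. (\<beta> j)\<^sup>2)"
proof -
  have "real s * A\<^sup>2 = (\<Sum>j | j < p \<and> \<beta> j \<noteq> 0. A\<^sup>2)" using assms(1) by (simp add: Xi_def)
  also have "\<dots> \<le> (\<Sum>j | j < p \<and> \<beta> j \<noteq> 0. (\<beta> j)\<^sup>2)"
  proof (rule sum_mono)
    fix j assume "j \<in> {j. j < p \<and> \<beta> j \<noteq> 0}"
    then have "A \<le> \<bar>\<beta> j\<bar>" using assms(1) by (simp add: Xi_def)
    from power_mono[OF this assms(2), of 2] show "A\<^sup>2 \<le> (\<beta> j)\<^sup>2" by simp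
  qed
  also have "\<dots> \<le> (\<Sum>j<p. (\<beta> j)\<^sup>2)" by (intro sum_mono2) auto
  finally show ?thesis .
qed

context regular_design
begin

lemma minimax_risk_upper:
  assumes p: "1 \<le> p" and n: "1 \<le> n" and \<alpha>: "0 < \<alpha>" "\<alpha> \<le> 1 / 2"
    and q: "64 * v\<^sup>2 * real p powr (- \<delta>) \<le> 1" and w: "0 \<le> w" and m: "1 \<le> (m::nat)"
  shows "minimax_risk D n p (sparsity \<alpha> p) (sqrt (real p powr (\<alpha> - 1/2 - \<delta>) / real n))
     \<le> 1 - w * (1 - exp (- (real p powr (- \<delta>) / 12))) + w ^ m * exp (2 * (real m)\<^sup>2)"
proof -
  let ?A = "sqrt (real p powr (\<alpha> - 1/2 - \<delta>) / real n)"
  define \<theta> where "\<theta> = real p powr (- 1 / 2)"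
  \<comment> \<open>A lower bound for \<theta> / (1 + 2 \<theta>) times |\<beta>|^2: the first
    factor is at least \<theta> / 3, and |\<beta>|^2 \<ge> s A^2 with s \<ge> p^(1 - \<alpha>) / 2.
    The exponents in \<alpha> cancel.\<close>
  define x where "x = real p powr (- \<delta>) / (6 * real n)"
  have \<theta>: "0 < \<theta>" "\<theta> \<le> 1" using p powr_mono[of "- 1 / 2" 0 "real p"] by (auto simp: \<theta>_def)
  have p\<theta>: "real p * \<theta>\<^sup>2 = 1"
  proof -
    have "\<theta>\<^sup>2 = real p powr (- 1)"
      by (simp only: \<theta>_def power2_eq_square powr_add[symmetric]) simp
    then show ?thesis using p by (simp add: powr_minus)
  qed
  have A: "0 < ?A" "?A\<^sup>2 = real p powr (\<alpha> - 1/2 - \<delta>) / real n" using p n by auto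
  note s = sparsity_bounds[OF p, of \<alpha>]
  have x0: "0 \<le> x" by (simp add: x_def)
  have xv: "64 * v\<^sup>2 * x \<le> 1"
  proof -
    have "real p powr (- \<delta>) / (6 * real n) \<le> real p powr (- \<delta>) / 1"
      using n by (intro divide_left_mono) auto
    then have "64 * v\<^sup>2 * x \<le> 64 * v\<^sup>2 * real p powr (- \<delta>)"
      unfolding x_def by (intro mult_left_mono) auto
    with q show ?thesis by linarith
  qed
  have "minimax_risk D n p (sparsity \<alpha> p) ?A
     \<le> 1 - w * (1 - exp (- (real n * x / 2))) + w ^ m * exp (2 * real p * (real m * \<theta>)\<^sup>2)"
  proof (rule minimax_risk_le[OF pos_def _ _ w m])
    show "Xi p (sparsity \<alpha> p) ?A \<noteq> {}" using s \<alpha> A by (intro Xi_nonempty) auto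
    show "0 \<le> \<theta>" using \<theta> by simp
    fix \<beta> assume \<beta>: "\<beta> \<in> Xi p (sparsity \<alpha> p) ?A"
    show "(\<integral>X. exp (- (\<theta> / (1 + 2 * \<theta>)) * (\<Sum>i<n. (\<Sum>j<p. X (i, j) * \<beta> j)\<^sup>2)) \<partial>D) \<le> exp (- (real n * x / 2))"
    proof (rule laplace_le[OF _ x0 _ xv])
      show "0 \<le> \<theta> / (1 + 2 * \<theta>)" using \<theta> by simp
      have "x = (\<theta> / 3) * (real p powr (1 - \<alpha>) / 2 * (real p powr (\<alpha> - 1/2 - \<delta>) / real n))"
        using p n by (simp add: x_def \<theta>_def powr_add[symmetric] field_simps)
      also have "\<dots> \<le> (\<theta> / (1 + 2 * \<theta>)) * (\<Sum>j<p. (\<beta> j)\<^sup>2)"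
      proof (rule mult_mono)
        show "\<theta> / 3 \<le> \<theta> / (1 + 2 * \<theta>)" using \<theta> by (intro divide_left_mono) auto
        have "real p powr (1 - \<alpha>) / 2 * (real p powr (\<alpha> - 1/2 - \<delta>) / real n) \<le> real (sparsity \<alpha> p) * ?A\<^sup>2"
          unfolding A(2) using s(1) \<alpha> by (intro mult_right_mono) auto
        also have "\<dots> \<le> (\<Sum>j<p. (\<beta> j)\<^sup>2)" using A(1) by (intro Xi_norm_ge[OF \<beta>]) simp
        finally show "real p powr (1 - \<alpha>) / 2 * (real p powr (\<alpha> - 1/2 - \<delta>) / real n) \<le> (\<Sum>j<p. (\<beta> j)\<^sup>2)" .
      qed (use \<theta> in auto)
      finally show "x \<le> (\<theta> / (1 + 2 * \<theta>)) * (\<Sum>j<p. (\<beta> j)\<^sup>2)" .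
    qed
  qed
  also have "real n * x / 2 = real p powr (- \<delta>) / 12" using n by (simp add: x_def)
  also have "2 * real p * (real m * \<theta>)\<^sup>2 = 2 * (real m)\<^sup>2"
  proof -
    have "2 * real p * (real m * \<theta>)\<^sup>2 = 2 * (real m)\<^sup>2 * (real p * \<theta>\<^sup>2)" by (simp add: power_mult_distrib)
    then show ?thesis by (simp add: p\<theta>)
  qed
  finally show ?thesis .
qed

text \<open>With Q = p^(-\<delta>), the logarithm of the second moment is at most 2 Q^2 from shared
  coordinates plus 128 v^2 Q^2 from the fluctuation of the design; its square root gives the rate
  Q.\<close>

lemma minimax_risk_lower:
  assumes p: "1 \<le> p" and pn: "p \<le> n" and \<alpha>: "0 < \<alpha>" "\<alpha> \<le> 1 / 2" and \<delta>: "0 < \<delta>"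
    and q: "64 * v\<^sup>2 * real p powr (- \<delta>) \<le> 1"
  shows "1 - minimax_risk D n p (sparsity \<alpha> p) (sqrt (real p powr (\<alpha> - 1/2 - \<delta>) / real n))
     \<le> 17 * v * real p powr (- \<delta>)"
proof -
  define A where "A = sqrt (real p powr (\<alpha> - 1/2 - \<delta>) / real n)"
  define s where "s = sparsity \<alpha> p"
  define m where "m = p div s"
  define Q where "Q = real p powr (- \<delta>)"
  define \<rho> where "\<rho> = real s * A\<^sup>2"
  have n: "0 < real n" and rp: "0 < real p" "1 \<le> real p" using p pn by auto
  have v: "0 < v" using v_ge_1 by simp
  have Q0: "0 < Q" using rp by (simp add: Q_def)
  have Q2: "Q\<^sup>2 = real p powr (- 2 * \<delta>)"
    by (simp add: Q_def power2_eq_square powr_add[symmetric])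
  note s = sparsity_bounds[OF p, of \<alpha>, folded s_def]
  have s': "real s \<le> real p powr (1 - \<alpha>)" "1 \<le> s" "s \<le> p" using s \<alpha> by auto
  have A: "0 < A" "A\<^sup>2 = real p powr (\<alpha> - 1/2 - \<delta>) / real n" using rp n by (auto simp: A_def)
  have sm: "s * m \<le> p" by (simp add: m_def)
  have m0: "0 < m" using s' by (simp add: m_def div_greater_zero_iff)
  \<comment> \<open>Rounding p / s down costs at most a factor 2, since m is at least 1.\<close>
  have m2: "real p \<le> 2 * real s * real m"
  proof -
    have "p < s * (m + 1)" using s' dividend_less_times_div[of s p] by (simp add: m_def)
    also have "\<dots> \<le> s * (2 * m)" using m0 by (intro mult_le_mono2) simp
    finally have "real p \<le> real (s * (2 * m))" by linarith
    then show ?thesis by simp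
  qed
  have nA: "real n * A\<^sup>2 = real p powr (\<alpha> - 1/2 - \<delta>)" using n by (simp add: A)
  \<comment> \<open>This is where \<alpha> \<le> 1/2 enters: a single coordinate carries a bounded
    signal, as the quadratic estimate of cosh requires.\<close>
  have nA1: "real n * A\<^sup>2 \<le> 1"
    unfolding nA using powr_mono[of "\<alpha> - 1/2 - \<delta>" 0 "real p"] \<alpha> \<delta> rp by simp
  have prior_part: "real s * (real n * A\<^sup>2)\<^sup>2 / real m \<le> 2 * Q\<^sup>2"
  proof -
    have "real s * (real n * A\<^sup>2)\<^sup>2 * real p \<le> real s * (real n * A\<^sup>2)\<^sup>2 * (2 * real s * real m)"
      using m2 by (intro mult_left_mono) auto
    then have "real s * (real n * A\<^sup>2)\<^sup>2 / real m \<le> 2 * ((real s)\<^sup>2 * (real n * A\<^sup>2)\<^sup>2 / real p)"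
      using m0 rp by (simp add: field_simps power2_eq_square)
    also have "(real s)\<^sup>2 * (real n * A\<^sup>2)\<^sup>2 / real p \<le> (real p powr (1 - \<alpha>))\<^sup>2 * (real n * A\<^sup>2)\<^sup>2 / real p"
      using s' by (intro divide_right_mono mult_right_mono power_mono) auto
    also have "\<dots> = Q\<^sup>2"
    proof -
      have "(real p powr (1 - \<alpha>))\<^sup>2 * (real p powr (\<alpha> - 1/2 - \<delta>))\<^sup>2 / real p powr 1 = real p powr (- 2 * \<delta>)"
        by (simp only: power2_eq_square powr_add[symmetric] powr_diff[symmetric])
           (simp add: algebra_simps)
      then show ?thesis using rp by (simp add: nA Q2)
    qed
    finally show ?thesis by simp
  qed
  have \<rho>0: "0 < \<rho>" using s' A(1) by (simp add: \<rho>_def)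
  have \<rho>_le: "\<rho> \<le> real p powr (1 / 2 - \<delta>) / real n"
  proof -
    have "\<rho> \<le> real p powr (1 - \<alpha>) * A\<^sup>2" unfolding \<rho>_def using s' by (intro mult_right_mono) auto
    also have "\<dots> = real p powr (1 / 2 - \<delta>) / real n" by (simp add: A powr_add[symmetric])
    finally show ?thesis .
  qed
  have half: "real p powr (1 / 2) * real p powr (1 / 2) = real p"
    using rp by (simp add: powr_add[symmetric])
  have split: "real p powr (1 / 2 - \<delta>) = real p powr (1 / 2) * Q"
    by (simp add: Q_def powr_add[symmetric])
  have \<rho>Q: "\<rho> \<le> Q"
  proof -
    have "real p powr (1 / 2) \<le> real p powr 1" using rp by (intro powr_mono) auto
    also have "\<dots> \<le> real n" using pn rp by simp
    finally have "real p powr (1 / 2) * Q / real n \<le> Q" using n Q0 by (simp add: field_simps)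
    then show ?thesis using \<rho>_le unfolding split by linarith
  qed
  have vQ: "64 * v\<^sup>2 * Q \<le> 1" using q by (simp add: Q_def)
  have v2: "v \<le> v\<^sup>2" using v_ge_1 by (simp add: power2_eq_square)
  have \<rho>v: "8 * v * \<rho> \<le> 1"
  proof -
    have "8 * v * \<rho> \<le> 8 * v * Q" using \<rho>Q v by (intro mult_left_mono) auto
    also have "\<dots> \<le> 64 * v\<^sup>2 * Q" using v2 v Q0 by (intro mult_right_mono) auto
    finally show ?thesis using vQ by linarith
  qed
  \<comment> \<open>The design contribution equals (p / n) Q^2 up to rounding of s, so n \<ge> p
    brings it down to the order of the prior contribution.\<close>
  have n\<rho>: "real n * \<rho>\<^sup>2 \<le> Q\<^sup>2"
  proof -
    have "real n * \<rho>\<^sup>2 \<le> real n * (real p powr (1 / 2) * Q / real n)\<^sup>2"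
      using \<rho>_le \<rho>0 unfolding split by (intro mult_left_mono power_mono) auto
    also have "\<dots> = (real p / real n) * Q\<^sup>2"
      using n half by (simp add: power2_eq_square field_simps)
    also have "\<dots> \<le> 1 * Q\<^sup>2" using pn n by (intro mult_right_mono) auto
    finally show ?thesis by simp
  qed
  let ?b = "prior_vec s m A" and ?I = "prior_index s m"
  define K where "K f g = exp (real n * (\<Sum>j<p. ?b f j * ?b g j) + 128 * v\<^sup>2 * real n * \<rho>\<^sup>2)" for f g
  have "1 - minimax_risk D n p s A \<le> 17 * v * Q"
  proof (rule one_minus_minimax_risk_le[where I = ?I and b = ?b and K = K])
    show "finite ?I" by (rule finite_prior_index)
    then have "card ?I \<noteq> 0" using m0 by (simp add: card_prior_index)
    then show "?I \<noteq> {}" by auto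
    show "?b f \<in> Xi p s A" if "f \<in> ?I" for f by (rule prior_vec_in_Xi[OF sm that A(1)])
    show "0 \<le> K f g" for f g by (simp add: K_def)
    show "(\<integral>\<^sup>+X. ennreal (exp (\<Sum>i<n. (\<Sum>j<p. X (i, j) * ?b f j) * (\<Sum>j<p. X (i, j) * ?b g j))) \<partial>D) \<le> ennreal (K f g)"
      if "f \<in> ?I" "g \<in> ?I" for f g
      unfolding K_def using prior_vec_norm[OF sm] that by (intro exp_inner_le[OF \<rho>0 \<rho>v]) (simp_all add: \<rho>_def)
    show "0 < 17 * v * Q" using v Q0 by simp
    have "(\<Sum>f\<in>?I. \<Sum>g\<in>?I. K f g) = exp (128 * v\<^sup>2 * real n * \<rho>\<^sup>2) * (\<Sum>f\<in>?I. \<Sum>g\<in>?I. exp (real n * (\<Sum>j<p. ?b f j * ?b g j)))"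
      by (simp add: K_def exp_add sum_distrib_left mult.commute)
    also have "\<dots> \<le> exp (128 * v\<^sup>2 * real n * \<rho>\<^sup>2) * ((real (card ?I))\<^sup>2 * exp (real s * (real n * A\<^sup>2)\<^sup>2 / real m))"
      using nA1 by (intro mult_left_mono sum_exp_prior_inner_le sm m0) auto
    also have "\<dots> = exp (128 * v\<^sup>2 * (real n * \<rho>\<^sup>2) + real s * (real n * A\<^sup>2)\<^sup>2 / real m) * (real (card ?I))\<^sup>2"
      by (simp add: exp_add mult_ac)
    also have "\<dots> \<le> (1 + (17 * v * Q)\<^sup>2) * (real (card ?I))\<^sup>2"
    proof (rule mult_right_mono)
      \<comment> \<open>130 = 128 + 2 collects both contributions. For y \<le> 1, exp y \<le> 1 + 2
        y = 1 + 260 v^2 Q^2, and 260 \<le> 17^2 explains the constant in the conclusion.\<close>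
      define y where "y = 130 * v\<^sup>2 * Q\<^sup>2"
      have v21: "1 \<le> v\<^sup>2" using v_ge_1 by simp
      have y: "0 \<le> y" "y \<le> 1"
      proof -
        show "0 \<le> y" by (simp add: y_def)
        have "1 * Q \<le> v\<^sup>2 * Q" using v21 Q0 by (intro mult_right_mono) auto
        then have Q64: "64 * Q \<le> 1" using vQ by simp
        have "64 * v\<^sup>2 * Q * Q \<le> 1 * Q" using vQ Q0 by (intro mult_right_mono) auto
        then show "y \<le> 1" using Q64 by (simp add: y_def power2_eq_square)
      qed
      have "128 * v\<^sup>2 * (real n * \<rho>\<^sup>2) \<le> 128 * v\<^sup>2 * Q\<^sup>2" using n\<rho> by (intro mult_left_mono) auto
      moreover have "1 * Q\<^sup>2 \<le> v\<^sup>2 * Q\<^sup>2" using v21 by (intro mult_right_mono) auto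
      ultimately have "128 * v\<^sup>2 * (real n * \<rho>\<^sup>2) + real s * (real n * A\<^sup>2)\<^sup>2 / real m \<le> y"
        using prior_part by (simp add: y_def)
      then have "exp (128 * v\<^sup>2 * (real n * \<rho>\<^sup>2) + real s * (real n * A\<^sup>2)\<^sup>2 / real m) \<le> exp y" by simp
      also have "\<dots> \<le> 1 + y + y\<^sup>2"
        by (rule exp_bound[OF y])
      also have "y\<^sup>2 \<le> y"
        using y by (simp add: power2_eq_square mult_left_le)
      also have "1 + y + y \<le> 1 + (17 * v * Q)\<^sup>2" by (simp add: y_def power_mult_distrib)
      finally show "exp (128 * v\<^sup>2 * (real n * \<rho>\<^sup>2) + real s * (real n * A\<^sup>2)\<^sup>2 / real m) \<le> 1 + (17 * v * Q)\<^sup>2"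
        by simp
    qed simp
    finally show "(\<Sum>f\<in>?I. \<Sum>g\<in>?I. K f g) \<le> (1 + (17 * v * Q)\<^sup>2) * (real (card ?I))\<^sup>2" .
  qed
  then show ?thesis by (simp add: s_def A_def Q_def)
qed

end

section \<open>Passage to logarithmic rates\<close>

lemma eventually_powr_neg_le:
  fixes c d \<delta> :: real
  assumes "0 < \<delta>" "0 < d"
  shows "eventually (\<lambda>p::nat. c * real p powr (- \<delta>) \<le> d) sequentially"
proof -
  have "(\<lambda>p::nat. c * real p powr (- \<delta>)) \<longlonglongrightarrow> c * 0"
    using assms(1) by (intro tendsto_mult_left tendsto_neg_powr filterlim_real_sequentially) auto
  then have "eventually (\<lambda>p::nat. c * real p powr (- \<delta>) < d) sequentially"
    using assms(2) by (intro order_tendstoD(2)) auto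
  then show ?thesis by eventually_elim simp
qed

lemma log_ratio_le:
  assumes "2 \<le> p" "0 < C" "1 - r \<le> C * real p powr (- \<delta>)"
  shows "log_ratio r p \<le> ereal (ln C / ln (real p) - \<delta>)"
proof (cases "1 - r \<le> 0")
  case False
  have "ln (1 - r) \<le> ln (C * real p powr (- \<delta>))" using False assms by simp
  also have "\<dots> = ln C - \<delta> * ln (real p)" using assms by (simp add: ln_mult ln_powr)
  finally have "ln (1 - r) / ln (real p) \<le> (ln C - \<delta> * ln (real p)) / ln (real p)"
    using assms by (intro divide_right_mono) auto
  also have "\<dots> = ln C / ln (real p) - \<delta>" using assms by (simp add: diff_divide_distrib)
  finally show ?thesis using False by (simp add: log_ratio_def)
qed (simp add: log_ratio_def)

lemma log_ratio_ge:
  assumes "2 \<le> p" "real p powr (- \<gamma>) \<le> 1 - r"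
  shows "ereal (- \<gamma>) \<le> log_ratio r p"
proof -
  have pos: "0 < real p powr (- \<gamma>)" using assms by simp
  have "ln (real p powr (- \<gamma>)) \<le> ln (1 - r)"
    using pos assms by (subst ln_le_cancel_iff) linarith+
  then have "- \<gamma> * ln (real p) \<le> ln (1 - r)" using assms by (simp add: ln_powr)
  moreover have "0 < ln (real p)" using assms by simp
  ultimately have "- \<gamma> \<le> ln (1 - r) / ln (real p)" by (simp add: pos_le_divide_eq)
  moreover have "\<not> 1 - r \<le> 0" using pos assms by linarith
  ultimately show ?thesis by (simp add: log_ratio_def)
qed

text \<open>With w = p^(-\<epsilon>) the test gains about w p^(-\<delta>), while the clipping error
  w^m is made negligible by a fixed large m. The loss of 2 \<epsilon> in the exponent is arbitrary
  and vanishes in the limit.\<close>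

lemma liminf_log_ratio_ge:
  fixes n :: "nat \<Rightarrow> nat" and D :: "nat \<Rightarrow> (nat \<times> nat \<Rightarrow> real) measure"
  assumes \<alpha>: "0 < \<alpha>" "\<alpha> \<le> 1 / 2" and \<delta>: "0 < \<delta>"
    and n: "filterlim n at_top at_top" and reg: "\<And>p. regular_design (D p) (n p) p v"
  shows "ereal (- \<delta>) \<le> liminf (\<lambda>p. log_ratio (minimax_risk (D p) (n p) p (sparsity \<alpha> p)
           (sqrt (real p powr (\<alpha> - 1/2 - \<delta>) / real (n p)))) p)" (is "_ \<le> liminf (\<lambda>p. log_ratio (?R p) p)")
proof (rule ereal_le_epsilon2)
  fix e :: real assume "0 < e"
  define \<epsilon> where "\<epsilon> = e / 2"
  have \<epsilon>: "0 < \<epsilon>" using \<open>0 < e\<close> by (simp add: \<epsilon>_def)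
  \<comment> \<open>Chosen so that w^m \<le> p^(-\<delta>) w^2: one factor w and p^(-\<delta>) match
    the gain, and the other factor w absorbs the moment constant E.\<close>
  define m where "m = nat \<lceil>(\<delta> + 2 * \<epsilon>) / \<epsilon>\<rceil>"
  have m_ge: "(\<delta> + 2 * \<epsilon>) / \<epsilon> \<le> real m" unfolding m_def by (rule real_nat_ceiling_ge)
  have m\<epsilon>: "\<delta> + 2 * \<epsilon> \<le> real m * \<epsilon>" using m_ge \<epsilon> by (simp add: pos_divide_le_eq)
  have m1: "1 \<le> m"
  proof -
    have "0 < (\<delta> + 2 * \<epsilon>) / \<epsilon>" using \<epsilon> \<delta> by simp
    then have "0 < real m" using m_ge by linarith
    then show ?thesis by simp
  qed
  define E where "E = exp (2 * (real m)\<^sup>2)"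
  have E: "1 \<le> E" by (simp add: E_def)
  have "eventually (\<lambda>p. ereal (- \<delta> - 2 * \<epsilon>) \<le> log_ratio (?R p) p) sequentially"
    using eventually_ge_at_top[of "2::nat"] n[unfolded filterlim_at_top, rule_format, of 1]
      eventually_powr_neg_le[OF \<delta>, of 1 "64 * v\<^sup>2", OF zero_less_one] eventually_powr_neg_le[OF \<epsilon>, of "1 / 48" E, simplified]
  proof eventually_elim
    case (elim p)
    interpret regular_design "D p" "n p" p v by (rule reg)
    define Q where "Q = real p powr (- \<delta>)"
    define w where "w = real p powr (- \<epsilon>)"
    have Q: "0 < Q" "Q \<le> 1"
    proof -
      show "0 < Q" using elim by (simp add: Q_def)
      show "Q \<le> 1" using elim \<delta> powr_mono[of "- \<delta>" 0 "real p"] by (simp add: Q_def)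
    qed
    have w: "0 < w" using elim by (simp add: w_def)
    have "?R p \<le> 1 - w * (1 - exp (- (Q / 12))) + w ^ m * E"
      unfolding Q_def E_def using minimax_risk_upper[of \<alpha> \<delta> w m] elim \<alpha> w m1 by simp
    moreover have "Q / 24 \<le> 1 - exp (- (Q / 12))"
    proof -
      have "(Q / 12)\<^sup>2 / 2 \<le> Q / 24"
        using Q mult_left_mono[of Q 1 Q] by (simp add: power2_eq_square)
      then show ?thesis using exp_minus_le_quadratic[of "Q / 12"] Q by simp
    qed
    then have "w * (Q / 24) \<le> w * (1 - exp (- (Q / 12)))" using w by (intro mult_left_mono) auto
    moreover have "w ^ m * E \<le> w * Q / 48"
    proof -
      have "w ^ m = real p powr (- (real m * \<epsilon>))"
        using elim by (simp add: w_def powr_realpow[symmetric] powr_powr mult.commute)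
      also have "\<dots> \<le> real p powr (- (\<delta> + 2 * \<epsilon>))" using m\<epsilon> elim by (intro powr_mono) auto
      also have "\<dots> = (w * Q) * w"
        by (simp add: w_def Q_def powr_add[symmetric] algebra_simps)
      finally have "w ^ m * E \<le> (w * Q) * w * E" using E by (intro mult_right_mono) auto
      also have "\<dots> = (w * Q) * (E * w)" by simp
      also have "\<dots> \<le> (w * Q) * (1 / 48)" using elim(4) w Q by (intro mult_left_mono) (auto simp: w_def)
      finally show ?thesis by simp
    qed
    ultimately have "w * Q / 48 \<le> 1 - ?R p" by simp
    \<comment> \<open>The constant 1/48 is paid for by one further factor w, which is below 1/48 for
      large p because E \<ge> 1.\<close>
    moreover have "w * Q * w \<le> w * Q / 48"
    proof -
      have "1 * w \<le> E * w" using E w by (intro mult_right_mono) auto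
      then have "w \<le> 1 / 48" using elim(4) by (simp add: w_def)
      then have "(w * Q) * w \<le> (w * Q) * (1 / 48)" using w Q by (intro mult_left_mono) auto
      then show ?thesis by simp
    qed
    moreover have "w * Q * w = real p powr (- (\<delta> + 2 * \<epsilon>))"
      by (simp add: w_def Q_def powr_add[symmetric] algebra_simps)
    ultimately have "real p powr (- (\<delta> + 2 * \<epsilon>)) \<le> 1 - ?R p" by simp
    then show ?case using log_ratio_ge[of p "\<delta> + 2 * \<epsilon>" "?R p"] elim(1) by simp
  qed
  then have "ereal (- \<delta> - 2 * \<epsilon>) \<le> liminf (\<lambda>p. log_ratio (?R p) p)"
    by (rule Liminf_bounded)
  then have "ereal (- \<delta> - 2 * \<epsilon>) + ereal (2 * \<epsilon>) \<le> liminf (\<lambda>p. log_ratio (?R p) p) + ereal (2 * \<epsilon>)"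
    by (rule add_right_mono)
  then show "ereal (- \<delta>) \<le> liminf (\<lambda>p. log_ratio (?R p) p) + ereal e"
    by (simp add: \<epsilon>_def)
qed

text \<open>The constant 17 v does not depend on p, so it contributes only ln (17 v) / ln p to the
  exponent, which tends to 0.\<close>

lemma liminf_log_ratio_le:
  fixes n :: "nat \<Rightarrow> nat" and D :: "nat \<Rightarrow> (nat \<times> nat \<Rightarrow> real) measure"
  assumes \<alpha>: "0 < \<alpha>" "\<alpha> \<le> 1 / 2" and \<delta>: "0 < \<delta>"
    and n: "eventually (\<lambda>p. p \<le> n p) sequentially" and reg: "\<And>p. regular_design (D p) (n p) p v"
  shows "liminf (\<lambda>p. log_ratio (minimax_risk (D p) (n p) p (sparsity \<alpha> p)
           (sqrt (real p powr (\<alpha> - 1/2 - \<delta>) / real (n p)))) p) \<le> ereal (- \<delta>)" (is "liminf (\<lambda>p. log_ratio (?R p) p) \<le> _")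
proof -
  have v: "1 \<le> v" using reg[of 0] by (rule regular_design.v_ge_1)
  have "eventually (\<lambda>p. log_ratio (?R p) p \<le> ereal (ln (17 * v) / ln (real p) - \<delta>)) sequentially"
    using eventually_ge_at_top[of "2::nat"] n eventually_powr_neg_le[OF \<delta>, of 1 "64 * v\<^sup>2", OF zero_less_one]
  proof eventually_elim
    case (elim p)
    interpret regular_design "D p" "n p" p v by (rule reg)
    show ?case
      using minimax_risk_lower[of \<alpha> \<delta>] elim \<alpha> \<delta> v by (intro log_ratio_le) auto
  qed
  then have "liminf (\<lambda>p. log_ratio (?R p) p) \<le> liminf (\<lambda>p. ereal (ln (17 * v) / ln (real p) - \<delta>))"
    by (rule Liminf_mono)
  also have "\<dots> = ereal (- \<delta>)"
  proof (rule lim_imp_Liminf)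
    have "(\<lambda>p. ln (17 * v) / ln (real p) - \<delta>) \<longlonglongrightarrow> 0 - \<delta>"
      by (intro tendsto_diff tendsto_const tendsto_divide_0[OF tendsto_const]
          filterlim_at_top_imp_at_infinity filterlim_compose[OF ln_at_top filterlim_real_sequentially])
    then show "(\<lambda>p. ereal (ln (17 * v) / ln (real p) - \<delta>)) \<longlonglongrightarrow> ereal (- \<delta>)" by simp
  qed simp
  finally show ?thesis .
qed

theorem mainTheorem1:
  fixes \<alpha> \<delta> \<sigma>2 :: real
    and n :: "nat \<Rightarrow> nat"
    and D :: "nat \<Rightarrow> (nat \<times> nat \<Rightarrow> real) measure"
  defines "R \<equiv> (\<lambda>p::nat. minimax_risk (D p) (n p) p
                (nat \<lfloor>real p powr (1 - \<alpha>)\<rfloor>)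
                (sqrt (real p powr (\<alpha> - 1/2 - \<delta>) / real (n p))))"
  assumes "0 < \<alpha>" and "\<alpha> \<le> 1/2" and "0 < \<delta>"
    and "filterlim n at_top at_top"
  shows
    "(\<delta> < 1/2 \<and>
       (((\<forall>p. subG_design \<sigma>2 (n p) p (D p)) \<and>
           filterlim (\<lambda>p. real (n p) / real p) at_top at_top) \<or>
        ((\<forall>p. orth_design (n p) p (D p)) \<and> (\<forall>p. p \<le> n p)))
      \<longrightarrow> liminf (\<lambda>p. log_ratio (R p) p) \<ge> ereal (- \<delta>))
     \<and>
     ((((\<forall>p. subG_design \<sigma>2 (n p) p (D p)) \<and>
           filterlim (\<lambda>p. real (n p) / real p powr (1 + 2 * \<delta>)) at_top at_top) \<or>
        ((\<forall>p. orth_design (n p) p (D p)) \<and> (\<forall>p. p \<le> n p)))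
      \<longrightarrow> liminf (\<lambda>p. log_ratio (R p) p) \<le> ereal (- \<delta>))"
proof -
  have reg: "\<exists>v. \<forall>p. regular_design (D p) (n p) p v"
    if "(\<forall>p. subG_design \<sigma>2 (n p) p (D p)) \<or> ((\<forall>p. orth_design (n p) p (D p)) \<and> (\<forall>p. p \<le> n p))"
    using that subG_regular orth_regular by blast
  \<comment> \<open>Since 1 + 2 \<delta> > 1, the growth condition for sub-Gaussian designs
    eventually gives the inequality p \<le> n that orthogonal designs satisfy by assumption.\<close>
  have n_ge: "eventually (\<lambda>p. p \<le> n p) sequentially"
    if lim: "filterlim (\<lambda>p. real (n p) / real p powr (1 + 2 * \<delta>)) at_top at_top"
    using lim[unfolded filterlim_at_top, rule_format, of 1] eventually_ge_at_top[of "1::nat"]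
  proof eventually_elim
    case (elim p)
    have "real p powr 1 \<le> real p powr (1 + 2 * \<delta>)" using elim assms(4) by (intro powr_mono) auto
    also have "\<dots> \<le> real (n p)" using elim by (simp add: pos_le_divide_eq)
    finally show ?case using elim by simp
  qed
  have R: "R p = minimax_risk (D p) (n p) p (sparsity \<alpha> p) (sqrt (real p powr (\<alpha> - 1/2 - \<delta>) / real (n p)))" for p
    by (simp add: R_def sparsity_def)
  show ?thesis
    unfolding R
    using liminf_log_ratio_ge[OF assms(2-5)] liminf_log_ratio_le[OF assms(2-4)] reg n_ge
    by (meson always_eventually)
qed

end
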